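(* Let $d=3$ and let $\xi$ be a random variable with support in $[0,1]$ such that $\mathbb{P}(\xi\in\{0,1\})=0$ and the support of $\xi$ contains at least two distinct points of $(0,1)$. Let $(L_n)_{n\ge 0}$ be the sequence of random triangles obtained from a non-degenerate triangle $L_0$ by the consecutive random subdivision procedure with splitting variable $\xi$. Then, almost surely, $L_n$ converges to a flat figure as $n\to\infty$.
   Context: Subdivision procedure. Let $L_0=A_1^{(0)}A_2^{(0)}\cdots A_d^{(0)}$ be a non-degenerate convex polygon with $d$ sides in the plane (here $d=3$). Let $\xi_j^{(n)}$, $1\le j\le d$, $n\ge 1$, be i.i.d. copies of $\xi$. Given $L_{n}=A_1^{(n)}\cdots A_d^{(n)}$ (with the convention $A_{d+1}^{(n)}=A_1^{(n)}$), let $A_j^{(n+1)}$ be the point of the segment $A_j^{(n)}A_{j+1}^{(n)}$ with $|A_j^{(n)}A_j^{(n+1)}|/|A_j^{(n)}A_{j+1}^{(n)}|=\xi_j^{(n+1)}$, and set $L_{n+1}=A_1^{(n+1)}\cdots A_d^{(n+1)}$. Let $l_j^{(n)}$ denote the vector from $A_j^{(n)}$ to $A_{j+1}^{(n)}$. The sequence $L_n$ converges to a flat figure if $\lim_{n\to\infty}\dfrac{\mathrm{Area}(L_n)}{\left(\max_{1\le j\le d}\|l_j^{(n)}\|\right)^2}=0$, where $\|\cdot\|$ is the Euclidean norm. *)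

theory Defs
  imports "HOL-Probability.Probability"
begin

text \<open>
  A polygon with \<open>d\<close> vertices is a function giving the vertices \<open>P 1, \<dots>, P d\<close>;
  its values outside \<open>{1..d}\<close> are irrelevant. Indices are cyclic: \<open>d + 1\<close> is read as \<open>1\<close>.
\<close>

type_synonym polygon = "nat \<Rightarrow> real ^ 2"

definition cyc_next :: "nat \<Rightarrow> nat \<Rightarrow> nat" where
  "cyc_next d j = (if j = d then 1 else j + 1)"

definition side :: "nat \<Rightarrow> polygon \<Rightarrow> nat \<Rightarrow> real ^ 2" where
  "side d P j = P (cyc_next d j) - P j"

definition subdivide :: "nat \<Rightarrow> (nat \<Rightarrow> real) \<Rightarrow> polygon \<Rightarrow> polygon" where
  "subdivide d t P j = P j + t j *\<^sub>R side d P j"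

text \<open>The subdivision point lies on the side and divides it in the prescribed ratio.\<close>

lemma subdivide_in_segment:
  assumes "0 \<le> t j" "t j \<le> 1"
  shows "subdivide d t P j \<in> closed_segment (P j) (P (cyc_next d j))"
  using assms unfolding subdivide_def side_def closed_segment_def
  by (auto intro!: exI[of _ "t j"] simp: algebra_simps)

lemma subdivide_ratio:
  assumes "0 \<le> t j" "P j \<noteq> P (cyc_next d j)"
  shows "dist (P j) (subdivide d t P j) / dist (P j) (P (cyc_next d j)) = t j"
  using assms unfolding subdivide_def side_def
  by (simp add: dist_norm norm_minus_commute)

text \<open>\<open>x j n\<close> is the splitting ratio used on side \<open>j\<close> in step \<open>n \<ge> 1\<close>.\<close>

primrec subdivision :: "nat \<Rightarrow> polygon \<Rightarrow> (nat \<Rightarrow> nat \<Rightarrow> real) \<Rightarrow> nat \<Rightarrow> polygon" where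
  "subdivision d L0 x 0 = L0"
| "subdivision d L0 x (Suc n) = subdivide d (\<lambda>j. x j (Suc n)) (subdivision d L0 x n)"

text \<open>
  The area is that of the convex hull of the vertices, i.e. the usual area of a convex polygon
  (in particular of a triangle, whatever its orientation).
\<close>

definition polygon_area :: "nat \<Rightarrow> polygon \<Rightarrow> real" where
  "polygon_area d P = measure lebesgue (convex hull (P ` {1..d}))"

definition converges_to_flat :: "nat \<Rightarrow> (nat \<Rightarrow> polygon) \<Rightarrow> bool" where
  "converges_to_flat d L \<longleftrightarrow>
     (\<lambda>n. polygon_area d (L n) / (Max ((\<lambda>j. norm (side d (L n) j)) ` {1..d}))\<^sup>2) \<longlonglongrightarrow> 0"

definition measure_support :: "'a::topological_space measure \<Rightarrow> 'a set" where
  "measure_support \<mu> = {x. \<forall>U. open U \<longrightarrow> x \<in> U \<longrightarrow> emeasure \<mu> U > 0}"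

end

theory Submission
  imports Defs
begin

text \<open>
  Identify the projection of a triangle to a line, up to translation, with a complex number: the
  first Fourier coefficient of the three reals. One subdivision then acts by a real-linear map
  \<open>z \<mapsto> \<alpha> z + \<beta> cnj z\<close>, whose determinant \<open>|\<alpha>|\<^sup>2 - |\<beta>|\<^sup>2\<close> is the ratio of the areas. Dividing by the
  root of the determinant gives a random walk by independent area-preserving linear maps of the
  plane, and the triangles become flat exactly if the norm of the product of these maps tends to
  infinity.

  That it does follows from a spectral gap for the action on square integrable functions on the
  plane: if the transition operator of the walk shrinks their norm by a fixed factor
  (\<open>step_op_contraction\<close>, \<open>rate_less_1\<close>), then the expected area of the set of points of the unit
  disc that lie in the unit disc again after \<open>n\<close> steps decays geometrically, so this area tends to
  \<open>0\<close> almost surely (\<open>escape_of_L2_contraction\<close>). As that set contains a disc with radius the inverse of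
  the norm of the product, capped at \<open>1\<close>, the norm tends to infinity (\<open>flat_of_escape\<close>). Steps
  that distort the plane badly still preserve the norm of functions, so they cannot spoil the gap.

  The gap comes from the cyclic symmetry of the three vertices. A cyclic shift of the three ratios
  multiplies \<open>\<beta>\<close> by a cube root of unity and leaves \<open>\<alpha>\<close> fixed. For the three maps so obtained the
  product of the factors by which they stretch a vector is, by the factorisation of
  \<open>x\<^sup>3 + y\<^sup>3\<close>, at least \<open>(|\<alpha>|\<^sup>3 - |\<beta>|\<^sup>3) / (|\<alpha>|\<^sup>2 - |\<beta>|\<^sup>2) powr (3 / 2)\<close>, and this exceeds \<open>1\<close> unless
  \<open>\<beta> = 0\<close> (\<open>logratio_sum\<close>, \<open>growth_pos\<close>). The three inverse maps have the same form, and they too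
  stretch every vector on average. Both cannot hold if the three inverse maps carry some
  measure to nearly the same measure, and this yields the contraction in quantitative form
  (\<open>three_stretch_contraction\<close>). Finally \<open>\<beta> = 0\<close> means that the three ratios agree, and two points
  in the support of the splitting variable exclude that this happens almost surely.
\<close>

section \<open>Area-preserving linear maps of the plane\<close>

text \<open>
  A bijective linear map pulls boxes back to parallelepipeds, whose volume is governed by the
  determinant; agreement on boxes determines Lebesgue measure.
\<close>

lemma distr_lborel_unimodular:
  fixes g :: "real^'n::{finite,wellorder} \<Rightarrow> real^'n::_"
  assumes g: "linear g" and h: "linear h" and gh: "\<And>x. g (h x) = x" "\<And>x. h (g x) = x"
    and det: "\<bar>det (matrix h)\<bar> = 1"
  shows "distr lborel borel g = lborel"
proof (rule lborel_eqI[symmetric])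
  have [measurable]: "g \<in> borel_measurable borel"
    using g by (intro borel_measurable_continuous_onI linear_continuous_on linear_conv_bounded_linear[THEN iffD1])
  fix l u :: "real^'n::_"
  assume lu: "\<And>b. b \<in> Basis \<Longrightarrow> l \<bullet> b \<le> u \<bullet> b"
  have eq: "g -` box l u = h ` box l u"
    using gh by (auto simp: image_iff) metis
  have "g -` box l u \<in> sets borel"
    using measurable_sets[of g borel borel "box l u"] by simp
  have m: "h ` box l u \<in> lmeasurable"
    using h by (intro measurable_linear_image) auto
  have "emeasure (distr lborel borel g) (box l u) = emeasure lborel (h ` box l u)"
    by (simp add: emeasure_distr eq)
  also have "\<dots> = emeasure lebesgue (h ` box l u)"
    using \<open>g -` box l u \<in> sets borel\<close> by (simp add: eq)
  also have "\<dots> = ennreal (measure lebesgue (h ` box l u))"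
    using m by (simp add: emeasure_eq_measure2)
  also have "measure lebesgue (h ` box l u) = measure lebesgue (box l u)"
    using h det by (subst measure_linear_image) auto
  also have "\<dots> = (\<Prod>b\<in>Basis. (u - l) \<bullet> b)"
    using lu by (simp add: measure_lborel_box_eq)
  finally show "emeasure (distr lborel borel g) (box l u) = (\<Prod>b\<in>Basis. (u - l) \<bullet> b)" .
qed simp

text \<open>
  The determinant formula is about \<open>real ^ 2\<close>, while the dynamics is clearest on the complex plane;
  this identification carries the measure from one to the other.
\<close>

lemma distr_lborel_Complex:
  "distr lborel borel (\<lambda>x :: real^2. Complex (x $ 1) (x $ 2)) = lborel"
proof (rule lborel_eqI[symmetric])
  have [measurable]: "(\<lambda>x :: real^2. Complex (x $ 1) (x $ 2)) \<in> borel_measurable borel"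
    by (intro borel_measurable_continuous_onI continuous_intros)
  fix l u :: complex
  assume "\<And>b. b \<in> Basis \<Longrightarrow> l \<bullet> b \<le> u \<bullet> b"
  from this[of 1] this[of \<i>] have lu: "Re l \<le> Re u" "Im l \<le> Im u"
    by (auto simp: Basis_complex_def)
  define v :: "complex \<Rightarrow> real^2" where "v z = (\<chi> i. if i = 1 then Re z else Im z)" for z
  have eq: "(\<lambda>x :: real^2. Complex (x $ 1) (x $ 2)) -` box l u = box (v l) (v u)"
    by (auto simp: mem_box_cart v_def forall_2 mem_box Basis_complex_def)
  have "emeasure (distr lborel borel (\<lambda>x :: real^2. Complex (x $ 1) (x $ 2))) (box l u)
      = emeasure lborel (box (v l) (v u))"
    by (simp add: emeasure_distr eq)
  also have "\<dots> = (\<Prod>b\<in>Basis. (v u - v l) \<bullet> b)"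
    using lu by (intro emeasure_lborel_box) 
      (auto simp: v_def Basis_vec_def inner_axis Basis_complex_def forall_2)
  also have "\<dots> = (Re u - Re l) * (Im u - Im l)"
    by (simp add: v_def Basis_vec_def inner_axis UNIV_2 axis_eq_axis mult.commute)
  also have "\<dots> = (\<Prod>b\<in>Basis. (u - l) \<bullet> b)"
    by (simp add: Basis_complex_def mult.commute)
  finally show "emeasure (distr lborel borel (\<lambda>x :: real^2. Complex (x $ 1) (x $ 2))) (box l u)
    = (\<Prod>b\<in>Basis. (u - l) \<bullet> b)" .
qed simp

text \<open>
  Every real-linear endomorphism of \<open>\<complex>\<close> is \<open>z \<mapsto> a z + b cnj z\<close> for unique \<open>a\<close> and \<open>b\<close>, and its
  determinant is \<open>|a|\<^sup>2 - |b|\<^sup>2\<close>. Dividing by the root of the determinant makes the map area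
  preserving. Only the orientation-preserving case \<open>|b| < |a|\<close> is of interest.
\<close>

definition stretch :: "complex \<Rightarrow> complex \<Rightarrow> complex \<Rightarrow> complex" where
  "stretch a b z = (a * z + b * cnj z) / of_real (sqrt ((cmod a)\<^sup>2 - (cmod b)\<^sup>2))"

lemma linear_stretch: "linear (stretch a b)"
  by (rule linearI) (auto simp: stretch_def algebra_simps add_divide_distrib scaleR_conv_of_real)

text \<open>
  The inverse is again of the form \<open>stretch\<close>, with coefficients of the same moduli. This symmetry
  is what later makes the growth estimate available for a map and its inverse alike.
\<close>

lemma stretch_inverse:
  assumes "cmod b < cmod a"
  shows "stretch (cnj a) (- b) (stretch a b z) = z" "stretch a b (stretch (cnj a) (- b) z) = z"
proof -
  define s where "s = sqrt ((cmod a)\<^sup>2 - (cmod b)\<^sup>2)"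
  have pos: "(cmod a)\<^sup>2 - (cmod b)\<^sup>2 > 0"
    using assms by (simp add: power_strict_mono)
  have "s > 0" "s * s = (cmod a)\<^sup>2 - (cmod b)\<^sup>2"
    using pos by (auto simp: s_def)
  then have s: "s > 0" "complex_of_real s * complex_of_real s = a * cnj a - b * cnj b"
    by (simp_all add: complex_norm_square[symmetric] flip: of_real_mult)
  have "stretch (cnj a) (- b) (stretch a b z) = (a * cnj a - b * cnj b) * z / (of_real s * of_real s)"
    "stretch a b (stretch (cnj a) (- b) z) = (a * cnj a - b * cnj b) * z / (of_real s * of_real s)"
    using s(1) unfolding stretch_def by (simp_all add: field_simps flip: s_def)
  then show "stretch (cnj a) (- b) (stretch a b z) = z" "stretch a b (stretch (cnj a) (- b) z) = z"
    using s(1) by (simp_all flip: s(2))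
qed

lemma distr_stretch:
  assumes ab: "cmod b < cmod a"
  shows "distr lborel borel (stretch a b) = lborel"
proof -
  define c :: "real^2 \<Rightarrow> complex" where "c x = Complex (x $ 1) (x $ 2)" for x
  define v :: "complex \<Rightarrow> real^2" where "v z = (\<chi> i. if i = 1 then Re z else Im z)" for z
  define g where "g a b = v \<circ> stretch a b \<circ> c" for a b
  have vc: "v (c x) = x" "c (v z) = z" for x z
    by (auto simp: v_def c_def vec_eq_iff forall_2 complex_eq_iff)
  have lin: "linear c" "linear v"
    by (auto intro!: linearI simp: c_def v_def vec_eq_iff complex_eq_iff)
  have lg: "linear (g a b)" for a b
    unfolding g_def by (intro linear_compose lin linear_stretch)
  have [measurable]: "c \<in> borel_measurable borel" "g a b \<in> borel_measurable borel"
      "stretch a b \<in> borel_measurable borel" for a b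
    using lin lg linear_stretch by (auto intro!: borel_measurable_continuous_onI linear_continuous_on linear_conv_bounded_linear[THEN iffD1])
  have det: "det (matrix (g a b)) = 1" if ab: "cmod b < cmod a" for a b
  proof -
    define s where "s = sqrt ((cmod a)\<^sup>2 - (cmod b)\<^sup>2)"
    have pos: "(cmod a)\<^sup>2 - (cmod b)\<^sup>2 > 0"
      using ab by (simp add: power_strict_mono)
    have s: "s > 0" "s * s = (Re a)\<^sup>2 + (Im a)\<^sup>2 - ((Re b)\<^sup>2 + (Im b)\<^sup>2)"
      using pos by (auto simp: s_def cmod_power2)
    have "c (axis 1 1) = 1" "c (axis 2 1) = \<i>"
      by (auto simp: c_def complex_eq_iff axis_def)
    then have "det (matrix (g a b)) =
       ((Re a + Re b) * (Re a - Re b) + (Im a + Im b) * (Im a - Im b)) / (s * s)"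
      using s(1) by (simp add: det_2 matrix_def g_def v_def stretch_def field_simps flip: s_def)
    also have "\<dots> = 1"
      using s by (simp add: power2_eq_square field_simps) 
    finally show ?thesis .
  qed
  have "distr lborel borel (g a b) = lborel"
  proof (rule distr_lborel_unimodular)
    show "linear (g (cnj a) (- b))" "linear (g a b)" by (rule lg)+
    show "\<bar>det (matrix (g (cnj a) (- b)))\<bar> = 1"
      using ab by (subst det) auto
  qed (use ab in \<open>auto simp: g_def vc stretch_inverse\<close>)
  then have "distr (distr lborel borel (g a b)) borel c = lborel"
    using distr_lborel_Complex by (simp add: c_def[abs_def])
  then have "distr lborel borel (c \<circ> g a b) = lborel"
    by (simp add: distr_distr)
  also have "c \<circ> g a b = stretch a b \<circ> c"
    by (auto simp: g_def vc fun_eq_iff)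
  also have "distr lborel borel (stretch a b \<circ> c) = distr (distr lborel borel c) borel (stretch a b)"
    by (simp add: distr_distr)
  also have "distr lborel borel c = lborel"
    using distr_lborel_Complex by (simp add: c_def[abs_def])
  finally show ?thesis .
qed

section \<open>Growth of three rotated copies of a linear map\<close>

text \<open>
  A primitive cube root of unity. Multiplying \<open>b\<close> by it rotates the two axes of \<open>stretch a b\<close> and
  corresponds to a cyclic relabelling of the vertices of the triangle.
\<close>

definition rot3 :: complex where "rot3 = cis (2 * pi / 3)"

lemma rot3: "norm rot3 = 1" "rot3 ^ 3 = 1" "rot3\<^sup>2 = - 1 - rot3"
  "Re rot3 = - 1 / 2" "Im rot3 = sqrt 3 / 2"
proof -
  show c: "norm rot3 = 1" by (simp add: rot3_def)
  show re: "Re rot3 = - 1 / 2" and im: "Im rot3 = sqrt 3 / 2"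
    by (simp_all add: rot3_def cos_120 sin_120)
  show p: "rot3\<^sup>2 = - 1 - rot3"
    by (simp add: complex_eq_iff re im power2_eq_square)
  show "rot3 ^ 3 = 1"
  proof -
    have "rot3 ^ 3 = rot3 * rot3\<^sup>2" by (simp add: power3_eq_cube power2_eq_square)
    also have "\<dots> = - rot3 - rot3\<^sup>2" by (simp add: p algebra_simps power2_eq_square[symmetric])
    finally show ?thesis by (simp add: p)
  qed
qed

lemma cube_sum_factor:
  "x ^ 3 + y ^ 3 = (x + y) * (x + rot3 * y) * (x + rot3\<^sup>2 * y)"
proof -
  have "(x + rot3 * y) * (x + rot3\<^sup>2 * y) = x\<^sup>2 + (rot3 + rot3\<^sup>2) * (x * y) + rot3 ^ 3 * y\<^sup>2"
    by (simp add: algebra_simps power2_eq_square power3_eq_cube)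
  also have "\<dots> = x\<^sup>2 - x * y + y\<^sup>2"
    unfolding rot3(2,3) by simp
  finally show ?thesis
    by (simp add: mult.assoc) (simp add: algebra_simps power2_eq_square power3_eq_cube)
qed

text \<open>
  The largest value of \<open>ln (|stretch a b z| / |z|)\<close> over all directions; the smallest is its negative.
\<close>

definition spread :: "complex \<Rightarrow> complex \<Rightarrow> real" where
  "spread a b = ln ((cmod a + cmod b) / sqrt ((cmod a)\<^sup>2 - (cmod b)\<^sup>2))"

text \<open>
  The minimum over all directions of the sum of the logarithmic growth rates of the three maps
  \<open>stretch a (rot3 ^ k * b)\<close>, see \<open>logratio_sum\<close> below.
\<close>

definition growth :: "complex \<Rightarrow> complex \<Rightarrow> real" where
  "growth a b = ln ((cmod a ^ 3 - cmod b ^ 3) / sqrt ((cmod a)\<^sup>2 - (cmod b)\<^sup>2) ^ 3)"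

definition logratio :: "complex \<Rightarrow> complex \<Rightarrow> complex \<Rightarrow> real" where
  "logratio a b z = ln (cmod (stretch a b z) / cmod z)"

lemma cmod_stretch:
  assumes "cmod b < cmod a"
  shows "cmod (stretch a b z) = cmod (a * z + b * cnj z) / sqrt ((cmod a)\<^sup>2 - (cmod b)\<^sup>2)"
  using assms by (simp add: stretch_def norm_divide power_mono)

lemma stretch_eq_0:
  assumes "cmod b < cmod a"
  shows "stretch a b z = 0 \<longleftrightarrow> z = 0"
  using stretch_inverse(1)[OF assms, of z] linear_0[OF linear_stretch] by metis

text \<open>
  The ratio \<open>|a z + b cnj z| / |z|\<close> lies between \<open>|a| - |b|\<close> and \<open>|a| + |b|\<close>, whose product is the
  determinant.
\<close>

lemma logratio_bound:
  assumes ab: "cmod b < cmod a" and z: "z \<noteq> 0"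
  shows "\<bar>logratio a b z\<bar> \<le> spread a b"
proof -
  define s where "s = sqrt ((cmod a)\<^sup>2 - (cmod b)\<^sup>2)"
  have pos: "(cmod a)\<^sup>2 - (cmod b)\<^sup>2 > 0"
    using ab by (simp add: power_strict_mono)
  have s: "s > 0" "s * s = (cmod a - cmod b) * (cmod a + cmod b)"
    using pos by (auto simp: s_def power2_eq_square algebra_simps)
  define q where "q = cmod (a * z + b * cnj z) / cmod z"
  have q: "logratio a b z = ln (q / s)"
    using ab by (simp add: logratio_def cmod_stretch q_def mult.commute flip: s_def)
  have "cmod (a * z + b * cnj z) \<le> cmod a * cmod z + cmod b * cmod z"
    using norm_triangle_ineq[of "a * z" "b * cnj z"] by (simp add: norm_mult)
  then have up: "q \<le> cmod a + cmod b"
    using z by (simp add: q_def field_simps)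
  have "cmod a * cmod z - cmod b * cmod z \<le> cmod (a * z + b * cnj z)"
    using norm_diff_ineq[of "a * z" "b * cnj z"] by (simp add: norm_mult)
  then have low: "cmod a - cmod b \<le> q"
    using z by (simp add: q_def field_simps)
  have q0: "q > 0" using low ab by linarith
  have pab: "cmod a + cmod b > 0"
    using ab norm_ge_zero[of b] by linarith
  have "ln (q / s) \<le> ln ((cmod a + cmod b) / s)"
    using q0 s up by (intro ln_mono divide_right_mono) auto
  moreover have "ln (s / (cmod a + cmod b)) \<le> ln (q / s)"
  proof (rule ln_mono)
    show "s / (cmod a + cmod b) \<le> q / s"
    proof -
      have "s * s \<le> q * (cmod a + cmod b)"
        using low pab by (simp add: s)
      then show ?thesis using pab s by (simp add: field_simps)
    qed
  qed (use s pab q0 in auto)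
  moreover have "ln (s / (cmod a + cmod b)) = - ln ((cmod a + cmod b) / s)"
    using s pab by (simp add: ln_div)
  ultimately show ?thesis by (simp add: q spread_def flip: s_def)
qed

lemma logratio_inverse:
  assumes "cmod b < cmod a" and "z \<noteq> 0"
  shows "logratio (cnj a) (- b) (stretch a b z) = - logratio a b z"
  using assms by (simp add: logratio_def stretch_inverse ln_div stretch_eq_0)

text \<open>
  The product of the three lengths collapses: with \<open>x = a z\<close> and \<open>y = b cnj z\<close> it is
  \<open>|x + y| |x + rot3 y| |x + rot3\<^sup>2 y| = |x\<^sup>3 + y\<^sup>3|\<close>, which is at least \<open>(|a|\<^sup>3 - |b|\<^sup>3) |z|\<^sup>3\<close>.
\<close>

lemma logratio_sum:
  assumes ab: "cmod b < cmod a" and z: "z \<noteq> 0"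
  shows "(\<Sum>k<3. logratio a (rot3 ^ k * b) z) \<ge> growth a b"
proof -
  define s where "s = sqrt ((cmod a)\<^sup>2 - (cmod b)\<^sup>2)"
  have s: "s > 0"
    using ab by (simp add: s_def power_strict_mono)
  have ab': "cmod (rot3 ^ k * b) < cmod a" for k
    using ab by (simp add: norm_mult norm_power rot3)
  define w where "w = cnj z"
  define q where "q k = cmod (a * z + (rot3 ^ k * b) * w) / cmod z" for k
  have eq: "logratio a (rot3 ^ k * b) z = ln (q k / s)" for k
    using ab'[of k] by (simp add: logratio_def cmod_stretch q_def w_def norm_mult norm_power rot3 mult.commute flip: s_def)
  have q0: "q k > 0" for k
    using ab'[of k] z stretch_eq_0[of "rot3 ^ k * b" a z] by (auto simp: q_def stretch_def w_def)
  have "(a * z) ^ 3 + (b * w) ^ 3 = (a * z + (rot3 ^ 0 * b) * w) * (a * z + (rot3 ^ 1 * b) * w) * (a * z + (rot3 ^ 2 * b) * w)"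
    using cube_sum_factor[of "a * z" "b * w"] by (simp add: mult.assoc)
  then have "q 0 * q 1 * q 2 = cmod ((a * z) ^ 3 + (b * w) ^ 3) / cmod z ^ 3"
    by (simp add: q_def norm_mult power3_eq_cube)
  moreover have "cmod ((a * z) ^ 3 + (b * w) ^ 3) \<ge> (cmod a ^ 3 - cmod b ^ 3) * cmod z ^ 3"
    using norm_diff_ineq[of "(a * z) ^ 3" "(b * w) ^ 3"]
    by (simp add: norm_mult norm_power w_def power_mult_distrib algebra_simps)
  ultimately have le: "cmod a ^ 3 - cmod b ^ 3 \<le> q 0 * q 1 * q 2"
    using z by (simp add: pos_le_divide_eq)
  have pos: "cmod a ^ 3 - cmod b ^ 3 > 0"
    using ab by (simp add: power_strict_mono)
  have "(\<Sum>k<3. logratio a (rot3 ^ k * b) z) = ln (q 0 / s) + ln (q 1 / s) + ln (q 2 / s)"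
    by (simp add: eq numeral_3_eq_3 numeral_2_eq_2 del: power_Suc)
  also have "\<dots> = ln (q 0 * q 1 * q 2 / s ^ 3)"
    using q0[of 0] q0[of 1] q0[of 2] s by (simp add: ln_div ln_mult ln_realpow)
  also have "\<dots> \<ge> ln ((cmod a ^ 3 - cmod b ^ 3) / s ^ 3)"
    using le pos s by (intro ln_mono divide_right_mono) auto
  finally show ?thesis by (simp add: growth_def s_def)
qed

lemma cubes_identity:
  fixes x y :: real
  shows "(x\<^sup>2 - y\<^sup>2) ^ 3
    = (x ^ 3 - y ^ 3)\<^sup>2 - (x - y)\<^sup>2 * (3 * (x * y)\<^sup>2 + 4 * x * y ^ 3 + 2 * y ^ 4)"
proof -
  have 1: "x\<^sup>2 - y\<^sup>2 = (x - y) * (x + y)" by algebra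
  have 2: "x ^ 3 - y ^ 3 = (x - y) * (x\<^sup>2 + x * y + y\<^sup>2)" by algebra
  have 3: "((x - y) * (x + y)) ^ 3 = (x - y)\<^sup>2 * ((x - y) * (x + y) ^ 3)"
    by (simp add: power_mult_distrib power3_eq_cube power2_eq_square)
  have 4: "(x - y) * (x + y) ^ 3
      = (x\<^sup>2 + x * y + y\<^sup>2)\<^sup>2 - (3 * (x * y)\<^sup>2 + 4 * x * y ^ 3 + 2 * y ^ 4)"
    by algebra
  show ?thesis
    by (simp only: 1 2 3 4 power_mult_distrib[of "x - y" _ 2] right_diff_distrib[of "(x - y)\<^sup>2"])
qed

text \<open>
  With \<open>x = |a|\<close> and \<open>y = |b|\<close> the claim is \<open>(x\<^sup>2 - y\<^sup>2)\<^sup>3 < (x\<^sup>3 - y\<^sup>3)\<^sup>2\<close>, where \<open>cubes_identity\<close>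
  exhibits the difference as a positive quantity.
\<close>

lemma growth_pos:
  assumes ab: "cmod b < cmod a" and b: "b \<noteq> 0"
  shows "growth a b > 0"
proof -
  define x y where "x = cmod a" and "y = cmod b"
  have xy: "0 < y" "y < x" using ab b by (auto simp: x_def y_def)
  define s where "s = sqrt (x\<^sup>2 - y\<^sup>2)"
  have p: "x\<^sup>2 - y\<^sup>2 > 0"
    using xy by (simp add: power_strict_mono)
  have s: "s > 0" "s\<^sup>2 = x\<^sup>2 - y\<^sup>2"
    using p by (auto simp: s_def)
  have "(s ^ 3)\<^sup>2 = (s\<^sup>2) ^ 3" by (simp flip: power_mult)
  also have "\<dots> = (x\<^sup>2 - y\<^sup>2) ^ 3" by (simp add: s)
  also have "\<dots> = (x ^ 3 - y ^ 3)\<^sup>2 - (x - y)\<^sup>2 * (3 * (x * y)\<^sup>2 + 4 * x * y ^ 3 + 2 * y ^ 4)"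
    by (rule cubes_identity)
  also have "\<dots> < (x ^ 3 - y ^ 3)\<^sup>2"
  proof -
    have "(x - y)\<^sup>2 * (3 * (x * y)\<^sup>2 + 4 * x * y ^ 3 + 2 * y ^ 4) > 0"
      using xy by (intro mult_pos_pos add_pos_pos) auto
    then show ?thesis by linarith
  qed
  finally have "s ^ 3 < x ^ 3 - y ^ 3"
    by (rule power_less_imp_less_base) (use xy in \<open>simp add: power_mono\<close>)
  then have "1 < (x ^ 3 - y ^ 3) / s ^ 3" using s by simp
  then show ?thesis unfolding growth_def by (simp add: x_def y_def s_def)
qed

lemma spread_pos:
  assumes ab: "cmod b < cmod a" and b: "b \<noteq> 0"
  shows "spread a b > 0"
proof -
  have "sqrt ((cmod a)\<^sup>2 - (cmod b)\<^sup>2) < sqrt ((cmod a + cmod b)\<^sup>2)"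
    using ab b by (subst real_sqrt_less_iff) (auto simp: power2_eq_square algebra_simps intro!: add_pos_nonneg mult_pos_pos)
  then show ?thesis
    unfolding spread_def using ab le_less_trans[OF norm_ge_zero ab]
    by (intro ln_gt_zero) (auto simp: power_strict_mono less_divide_eq)
qed

section \<open>The average over three rotated copies contracts\<close>

lemma stretch_measurable [measurable]: "stretch a b \<in> borel_measurable borel"
  using linear_stretch by (auto intro!: borel_measurable_continuous_onI linear_continuous_on linear_conv_bounded_linear[THEN iffD1])

lemma logratio_measurable [measurable]: "logratio a b \<in> borel_measurable borel"
  unfolding logratio_def[abs_def] by measurable

lemma integral_stretch:
  fixes f :: "complex \<Rightarrow> real"
  assumes "cmod b < cmod a" and [measurable]: "f \<in> borel_measurable borel"
  shows "(\<integral>z. f (stretch a b z) \<partial>lborel) = (\<integral>z. f z \<partial>lborel)"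
    and "integrable lborel (\<lambda>z. f (stretch a b z)) \<longleftrightarrow> integrable lborel f"
  using integral_distr[of "stretch a b" lborel borel f] integrable_distr_eq[of "stretch a b" lborel borel f]
    distr_stretch[OF assms(1)] by simp_all

text \<open>
  Young's inequality for \<open>\<bar>x - y\<bar> * \<bar>x + y\<bar>\<close>; after integration it plays the role of the
  Cauchy--Schwarz inequality.
\<close>

lemma abs_square_diff_le:
  fixes x y \<eta> :: real
  assumes "\<eta> > 0"
  shows "\<bar>x\<^sup>2 - y\<^sup>2\<bar> \<le> \<eta> * (x\<^sup>2 + y\<^sup>2) + (x - y)\<^sup>2 / (2 * \<eta>)"
proof -
  define u v where "u = \<bar>x - y\<bar>" and "v = \<bar>x + y\<bar>"
  have "0 \<le> (u - \<eta> * v)\<^sup>2" by simp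
  then have "2 * \<eta> * (u * v) \<le> u\<^sup>2 + \<eta>\<^sup>2 * v\<^sup>2"
    by (simp add: power2_eq_square algebra_simps)
  then have "u * v \<le> (u\<^sup>2 + \<eta>\<^sup>2 * v\<^sup>2) / (2 * \<eta>)"
    using assms by (simp add: pos_le_divide_eq mult.commute)
  also have "\<dots> = u\<^sup>2 / (2 * \<eta>) + \<eta> / 2 * v\<^sup>2"
    using assms by (simp add: field_simps power2_eq_square)
  also have "\<eta> / 2 * v\<^sup>2 \<le> \<eta> * (x\<^sup>2 + y\<^sup>2)"
  proof -
    have "v\<^sup>2 \<le> 2 * (x\<^sup>2 + y\<^sup>2)"
      using zero_le_power2[of "x - y"] by (simp add: v_def power2_eq_square algebra_simps)
    then have "\<eta> / 2 * v\<^sup>2 \<le> \<eta> / 2 * (2 * (x\<^sup>2 + y\<^sup>2))"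
      using assms by (intro mult_left_mono) auto
    then show ?thesis by (simp add: algebra_simps)
  qed
  also have "u * v = \<bar>x\<^sup>2 - y\<^sup>2\<bar>"
    by (simp add: u_def v_def power2_eq_square algebra_simps flip: abs_mult)
  finally show ?thesis by (simp add: u_def)
qed

text \<open>
  The constant comes out of the proof of \<open>three_stretch_contraction\<close>. For \<open>b = 0\<close> the three maps
  there coincide; then \<open>growth a b = 0\<close>, and the value is \<open>0\<close>.
\<close>

definition gap :: "complex \<Rightarrow> complex \<Rightarrow> real" where
  "gap a b = (growth a b)\<^sup>2 / (18 * (spread a b)\<^sup>2)"

text \<open>
  The three functions \<open>h k\<close> have the norm of \<open>f\<close>, so their average is shorter than \<open>f\<close> by an amount
  controlled by the distances between them, and they have to be shown to differ. If they nearly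
  agreed, the measures \<open>(h k)\<^sup>2 dz\<close> would nearly agree, and so would the mean logarithmic growth of
  the three maps computed with \<open>(h 0)\<^sup>2\<close> and with the respective \<open>(h k)\<^sup>2\<close>. The sum of the former is at
  least \<open>growth a b\<close> times the total mass. But \<open>(h k)\<^sup>2 dz\<close> is carried to \<open>f\<^sup>2 dz\<close> by the \<open>k\<close>-th map,
  so the sum of the latter is minus the sum of the mean growth rates of the three inverse maps under
  \<open>f\<^sup>2 dz\<close>; the inverses obey the same lower bound, which makes it negative.
\<close>

lemma three_stretch_contraction:
  fixes f :: "complex \<Rightarrow> real"
  assumes ab: "cmod b < cmod a" and [measurable]: "f \<in> borel_measurable borel"
    and f2: "integrable lborel (\<lambda>z. (f z)\<^sup>2)"
  defines "h \<equiv> \<lambda>k z. f (stretch a (rot3 ^ k * b) z)"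
  shows "integrable lborel (\<lambda>z. ((h 0 z + h 1 z + h 2 z) / 3)\<^sup>2)" (is ?int)
    and "(\<integral>z. ((h 0 z + h 1 z + h 2 z) / 3)\<^sup>2 \<partial>lborel) \<le> (1 - gap a b) * (\<integral>z. (f z)\<^sup>2 \<partial>lborel)" (is ?le)
proof -
  have ab': "cmod (rot3 ^ k * b) < cmod a" for k
    using ab by (simp add: norm_mult norm_power rot3)
  have [measurable]: "h k \<in> borel_measurable borel" for k
    unfolding h_def by measurable
  define m where "m = (\<integral>z. (f z)\<^sup>2 \<partial>lborel)"
  have h2: "integrable lborel (\<lambda>z. (h k z)\<^sup>2)" "(\<integral>z. (h k z)\<^sup>2 \<partial>lborel) = m" for k
    using f2 integral_stretch[OF ab'[of k], of "\<lambda>z. (f z)\<^sup>2"] by (simp_all add: h_def m_def)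
  have d2: "integrable lborel (\<lambda>z. (h k z - h l z)\<^sup>2)" for k l
  proof (rule Bochner_Integration.integrable_bound)
    show "integrable lborel (\<lambda>z. 2 * ((h k z)\<^sup>2 + (h l z)\<^sup>2))"
      using h2 by simp
    show "AE z in lborel. norm ((h k z - h l z)\<^sup>2) \<le> norm (2 * ((h k z)\<^sup>2 + (h l z)\<^sup>2))"
    proof (rule AE_I2)
      fix z
      have "(h k z - h l z)\<^sup>2 \<le> 2 * ((h k z)\<^sup>2 + (h l z)\<^sup>2)"
        using zero_le_power2[of "h k z + h l z"] by (simp add: power2_eq_square algebra_simps)
      then show "norm ((h k z - h l z)\<^sup>2) \<le> norm (2 * ((h k z)\<^sup>2 + (h l z)\<^sup>2))"
        by simp
    qed
  qed simp
  define d where "d k l = (\<integral>z. (h k z - h l z)\<^sup>2 \<partial>lborel)" for k l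
  have d0: "d k l \<ge> 0" for k l
    by (simp add: d_def)
  have eq: "((h 0 z + h 1 z + h 2 z) / 3)\<^sup>2 = ((h 0 z)\<^sup>2 + (h 1 z)\<^sup>2 + (h 2 z)\<^sup>2) / 3
      - ((h 0 z - h 1 z)\<^sup>2 + (h 0 z - h 2 z)\<^sup>2 + (h 1 z - h 2 z)\<^sup>2) / 9" for z
    by (simp add: power2_eq_square field_simps)
  show ?int
    unfolding eq using h2 d2 by simp
  have val: "(\<integral>z. ((h 0 z + h 1 z + h 2 z) / 3)\<^sup>2 \<partial>lborel) = m - (d 0 1 + d 0 2 + d 1 2) / 9"
    unfolding eq using h2 d2 by (simp add: d_def)
  show ?le
  proof (cases "b = 0")
    case True
    then have "gap a b = 0"
      using ab by (simp add: gap_def growth_def)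
    then show ?thesis
      using d0[of 0 1] d0[of 0 2] d0[of 1 2] unfolding val by (simp add: m_def)
  next
    case False
    define c L where "c = growth a b" and "L = spread a b"
    have cL: "c > 0" "L > 0"
      using growth_pos[OF ab False] spread_pos[OF ab False] by (auto simp: c_def L_def)
    define \<phi> where "\<phi> k = logratio a (rot3 ^ k * b)" for k
    define \<psi> where "\<psi> k = logratio (cnj a) (- (rot3 ^ k * b))" for k
    have [measurable]: "\<phi> k \<in> borel_measurable borel" "\<psi> k \<in> borel_measurable borel" for k
      unfolding \<phi>_def \<psi>_def by measurable
    have \<phi>: "\<bar>\<phi> k z\<bar> \<le> L" "\<bar>\<psi> k z\<bar> \<le> L" if "z \<noteq> 0" for k z
      using logratio_bound[OF ab'[of k] that] logratio_bound[of "- (rot3 ^ k * b)" "cnj a" z] ab'[of k] that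
      by (auto simp: \<phi>_def \<psi>_def L_def spread_def norm_mult norm_power rot3)
    have \<phi>_sum: "\<phi> 0 z + \<phi> 1 z + \<phi> 2 z \<ge> c" if "z \<noteq> 0" for z
      using logratio_sum[OF ab that] by (simp add: \<phi>_def c_def numeral_3_eq_3 numeral_2_eq_2 del: power_Suc)
    have \<psi>_sum: "\<psi> 0 z + \<psi> 1 z + \<psi> 2 z \<ge> c" if "z \<noteq> 0" for z
      using logratio_sum[of "- b" "cnj a" z] ab that 
      by (simp add: \<psi>_def c_def growth_def numeral_3_eq_3 numeral_2_eq_2 del: power_Suc)
    have nz: "AE z in lborel. (z :: complex) \<noteq> 0"
      by (rule AE_lborel_singleton)
    have int: "integrable lborel (\<lambda>z. \<phi> k z * (h l z)\<^sup>2)" for k l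
    proof (rule Bochner_Integration.integrable_bound[OF integrable_mult_right[OF h2(1), of L l]])
      show "AE z in lborel. norm (\<phi> k z * (h l z)\<^sup>2) \<le> norm (L * (h l z)\<^sup>2)"
        using nz by (rule eventually_mono) (use \<phi> cL in \<open>auto simp: abs_mult intro!: mult_right_mono\<close>)
    qed measurable
    have int': "integrable lborel (\<lambda>z. \<psi> k z * (f z)\<^sup>2)" for k
    proof (rule Bochner_Integration.integrable_bound[OF integrable_mult_right[OF f2, of L]])
      show "AE z in lborel. norm (\<psi> k z * (f z)\<^sup>2) \<le> norm (L * (f z)\<^sup>2)"
        using nz by (rule eventually_mono) (use \<phi> cL in \<open>auto simp: abs_mult intro!: mult_right_mono\<close>)
    qed measurable
    \<comment> \<open>Change of variables by the \<open>k\<close>-th map turns growth under the inverse into minus growth under the map.\<close>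
    have \<psi>_int: "(\<integral>z. \<psi> k z * (f z)\<^sup>2 \<partial>lborel) = - (\<integral>z. \<phi> k z * (h k z)\<^sup>2 \<partial>lborel)" for k
    proof -
      have "(\<integral>z. \<psi> k z * (f z)\<^sup>2 \<partial>lborel) = (\<integral>z. \<psi> k (stretch a (rot3 ^ k * b) z) * (h k z)\<^sup>2 \<partial>lborel)"
        unfolding h_def by (subst integral_stretch(1)[OF ab'[of k], of "\<lambda>z. \<psi> k z * (f z)\<^sup>2", symmetric]) auto
      also have "\<dots> = (\<integral>z. - (\<phi> k z * (h k z)\<^sup>2) \<partial>lborel)"
      proof (rule integral_cong_AE)
        show "AE z in lborel. \<psi> k (stretch a (rot3 ^ k * b) z) * (h k z)\<^sup>2 = - (\<phi> k z * (h k z)\<^sup>2)"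
          using nz by (rule eventually_mono) (use logratio_inverse[OF ab'[of k]] in \<open>auto simp: \<psi>_def \<phi>_def\<close>)
      qed measurable
      finally show ?thesis by simp
    qed
    have "c * m \<le> (\<integral>z. \<psi> 0 z * (f z)\<^sup>2 + \<psi> 1 z * (f z)\<^sup>2 + \<psi> 2 z * (f z)\<^sup>2 \<partial>lborel)"
      unfolding m_def integral_mult_right_zero[symmetric]
    proof (rule integral_mono_AE)
      show "AE z in lborel. c * (f z)\<^sup>2 \<le> \<psi> 0 z * (f z)\<^sup>2 + \<psi> 1 z * (f z)\<^sup>2 + \<psi> 2 z * (f z)\<^sup>2"
        using nz by (rule eventually_mono) (use \<psi>_sum in \<open>auto intro!: mult_right_mono simp flip: distrib_right\<close>)
    qed (use f2 int' in simp_all)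
    also have "\<dots> = - (\<integral>z. \<phi> 0 z * (h 0 z)\<^sup>2 + \<phi> 1 z * (h 1 z)\<^sup>2 + \<phi> 2 z * (h 2 z)\<^sup>2 \<partial>lborel)"
      using int int' by (simp add: \<psi>_int)
    finally have 1: "(\<integral>z. \<phi> 0 z * (h 0 z)\<^sup>2 + \<phi> 1 z * (h 1 z)\<^sup>2 + \<phi> 2 z * (h 2 z)\<^sup>2 \<partial>lborel) \<le> - (c * m)"
      by simp
    have 2: "c * m \<le> (\<integral>z. \<phi> 0 z * (h 0 z)\<^sup>2 + \<phi> 1 z * (h 0 z)\<^sup>2 + \<phi> 2 z * (h 0 z)\<^sup>2 \<partial>lborel)"
      unfolding h2(2)[of 0, symmetric] integral_mult_right_zero[symmetric]
    proof (rule integral_mono_AE)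
      show "AE z in lborel. c * (h 0 z)\<^sup>2 \<le> \<phi> 0 z * (h 0 z)\<^sup>2 + \<phi> 1 z * (h 0 z)\<^sup>2 + \<phi> 2 z * (h 0 z)\<^sup>2"
        using nz by (rule eventually_mono) (use \<phi>_sum in \<open>auto intro!: mult_right_mono simp flip: distrib_right\<close>)
    qed (use h2(1) int in simp_all)
    \<comment> \<open>With this value the terms of Young's inequality that carry the mass absorb exactly half of \<open>2 * (c * m)\<close>.\<close>
    define \<eta> where "\<eta> = c / (4 * L)"
    have \<eta>: "\<eta> > 0" using cL by (simp add: \<eta>_def)
    have *: "\<phi> k z * (h 0 z)\<^sup>2 \<le> \<phi> k z * (h k z)\<^sup>2
       + L * (\<eta> * ((h 0 z)\<^sup>2 + (h k z)\<^sup>2) + (h 0 z - h k z)\<^sup>2 / (2 * \<eta>))" if "z \<noteq> 0" for k z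
    proof -
      have "\<phi> k z * ((h 0 z)\<^sup>2 - (h k z)\<^sup>2) \<le> \<bar>\<phi> k z\<bar> * \<bar>(h 0 z)\<^sup>2 - (h k z)\<^sup>2\<bar>"
        by (metis abs_ge_self abs_mult)
      also have "\<dots> \<le> L * (\<eta> * ((h 0 z)\<^sup>2 + (h k z)\<^sup>2) + (h 0 z - h k z)\<^sup>2 / (2 * \<eta>))"
        using \<phi>(1)[OF that] cL by (intro mult_mono abs_square_diff_le \<eta>) auto
      finally show ?thesis by (simp add: right_diff_distrib)
    qed
    have "(\<integral>z. \<phi> 0 z * (h 0 z)\<^sup>2 + \<phi> 1 z * (h 0 z)\<^sup>2 + \<phi> 2 z * (h 0 z)\<^sup>2 \<partial>lborel)
      \<le> (\<integral>z. (\<phi> 0 z * (h 0 z)\<^sup>2 + \<phi> 1 z * (h 1 z)\<^sup>2 + \<phi> 2 z * (h 2 z)\<^sup>2)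
          + (L * (\<eta> * ((h 0 z)\<^sup>2 + (h 1 z)\<^sup>2) + (h 0 z - h 1 z)\<^sup>2 / (2 * \<eta>))
           + L * (\<eta> * ((h 0 z)\<^sup>2 + (h 2 z)\<^sup>2) + (h 0 z - h 2 z)\<^sup>2 / (2 * \<eta>))) \<partial>lborel)"
    proof (rule integral_mono_AE)
      show "AE z in lborel. \<phi> 0 z * (h 0 z)\<^sup>2 + \<phi> 1 z * (h 0 z)\<^sup>2 + \<phi> 2 z * (h 0 z)\<^sup>2
        \<le> (\<phi> 0 z * (h 0 z)\<^sup>2 + \<phi> 1 z * (h 1 z)\<^sup>2 + \<phi> 2 z * (h 2 z)\<^sup>2)
          + (L * (\<eta> * ((h 0 z)\<^sup>2 + (h 1 z)\<^sup>2) + (h 0 z - h 1 z)\<^sup>2 / (2 * \<eta>))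
           + L * (\<eta> * ((h 0 z)\<^sup>2 + (h 2 z)\<^sup>2) + (h 0 z - h 2 z)\<^sup>2 / (2 * \<eta>)))"
        using nz
      proof (rule eventually_mono)
        fix z :: complex assume "z \<noteq> 0"
        from *[OF this, of 1] *[OF this, of 2] show "\<phi> 0 z * (h 0 z)\<^sup>2 + \<phi> 1 z * (h 0 z)\<^sup>2 + \<phi> 2 z * (h 0 z)\<^sup>2
        \<le> (\<phi> 0 z * (h 0 z)\<^sup>2 + \<phi> 1 z * (h 1 z)\<^sup>2 + \<phi> 2 z * (h 2 z)\<^sup>2)
          + (L * (\<eta> * ((h 0 z)\<^sup>2 + (h 1 z)\<^sup>2) + (h 0 z - h 1 z)\<^sup>2 / (2 * \<eta>))
           + L * (\<eta> * ((h 0 z)\<^sup>2 + (h 2 z)\<^sup>2) + (h 0 z - h 2 z)\<^sup>2 / (2 * \<eta>)))"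
          by linarith
      qed
    qed (use int h2 d2 in simp_all)
    also have "\<dots> = (\<integral>z. \<phi> 0 z * (h 0 z)\<^sup>2 + \<phi> 1 z * (h 1 z)\<^sup>2 + \<phi> 2 z * (h 2 z)\<^sup>2 \<partial>lborel)
        + (L * (\<eta> * (m + m) + d 0 1 / (2 * \<eta>)) + L * (\<eta> * (m + m) + d 0 2 / (2 * \<eta>)))"
      using int h2 d2 by (simp add: d_def)
    finally have "2 * (c * m) \<le> L * (\<eta> * (m + m) + d 0 1 / (2 * \<eta>)) + L * (\<eta> * (m + m) + d 0 2 / (2 * \<eta>))"
      using 1 2 by linarith
    also have "\<dots> = c * m + 2 * L\<^sup>2 * (d 0 1 + d 0 2) / c"
      using cL by (simp add: \<eta>_def field_simps power2_eq_square)
    finally have "c * m \<le> 2 * L\<^sup>2 * (d 0 1 + d 0 2) / c" by simp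
    then have "c\<^sup>2 * m \<le> 2 * L\<^sup>2 * (d 0 1 + d 0 2)"
      using cL by (simp add: pos_le_divide_eq power2_eq_square mult_ac)
    then have "gap a b * m \<le> (d 0 1 + d 0 2) / 9"
      using cL by (simp add: gap_def pos_divide_le_eq field_simps flip: c_def L_def)
    then show ?thesis
      using d0[of 1 2] unfolding val by (simp add: m_def algebra_simps)
  qed
qed

section \<open>Random walks with a contracting transition operator\<close>

text \<open>
  The parameters are numbered from \<open>1\<close>, like the steps of the subdivision.
\<close>

primrec orbit :: "('p \<Rightarrow> 'c \<Rightarrow> 'c) \<Rightarrow> (nat \<Rightarrow> 'p) \<Rightarrow> nat \<Rightarrow> 'c \<Rightarrow> 'c" where
  "orbit G y 0 z = z"
| "orbit G y (Suc n) z = G (y (Suc n)) (orbit G y n z)"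

text \<open>
  The transition operator of the random walk whose step is \<open>G p\<close> with \<open>p\<close> distributed by \<open>P\<close>.
\<close>

definition step_op :: "'p measure \<Rightarrow> ('p \<Rightarrow> 'c \<Rightarrow> 'c) \<Rightarrow> ('c \<Rightarrow> real) \<Rightarrow> 'c \<Rightarrow> real" where
  "step_op P G f z = (\<integral>p. f (G p z) \<partial>P)"

lemma orbit_cong:
  "(\<And>i. i \<in> {1..n} \<Longrightarrow> y i = y' i) \<Longrightarrow> orbit G y n z = orbit G y' n z"
  by (induction n) auto

lemma orbit_measurable:
  assumes G: "case_prod G \<in> S \<Otimes>\<^sub>M C \<rightarrow>\<^sub>M C" and Y: "\<And>i. i \<in> {1..n} \<Longrightarrow> Y i \<in> N \<rightarrow>\<^sub>M S"
  shows "(\<lambda>(\<omega>, z). orbit G (\<lambda>i. Y i \<omega>) n z) \<in> N \<Otimes>\<^sub>M C \<rightarrow>\<^sub>M C"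
  using Y
proof (induction n)
  case (Suc n)
  have [measurable]: "(\<lambda>(\<omega>, z). orbit G (\<lambda>i. Y i \<omega>) n z) \<in> N \<Otimes>\<^sub>M C \<rightarrow>\<^sub>M C" "Y (Suc n) \<in> N \<rightarrow>\<^sub>M S"
    using Suc by auto
  have "(\<lambda>x. case_prod G (Y (Suc n) (fst x), (\<lambda>(\<omega>, z). orbit G (\<lambda>i. Y i \<omega>) n z) x)) \<in> N \<Otimes>\<^sub>M C \<rightarrow>\<^sub>M C"
    by (rule measurable_compose[OF _ G]) measurable
  then show ?case by (simp add: case_prod_unfold)
qed (simp add: case_prod_unfold)

lemma step_op_measurable:
  fixes f :: "'c \<Rightarrow> real"
  assumes "prob_space P" and G: "case_prod G \<in> P \<Otimes>\<^sub>M C \<rightarrow>\<^sub>M C" and f: "f \<in> borel_measurable C"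
  shows "step_op P G f \<in> borel_measurable C"
proof -
  interpret prob_space P by fact
  have "(\<lambda>x. f (case_prod G (snd x, fst x))) \<in> borel_measurable (C \<Otimes>\<^sub>M P)"
    by (rule measurable_compose[OF _ f], rule measurable_compose[OF _ G]) measurable
  then have [measurable]: "(\<lambda>(z, p). f (G p z)) \<in> borel_measurable (C \<Otimes>\<^sub>M P)"
    by (simp add: case_prod_unfold)
  show ?thesis
    unfolding step_op_def[abs_def] by measurable
qed

lemma step_op_bounds:
  fixes f :: "'c \<Rightarrow> real"
  assumes "prob_space P" and "\<And>z. f z \<in> {0..1}"
  shows "step_op P G f z \<in> {0..1}"
proof -
  interpret prob_space P by fact
  have "step_op P G f z \<le> 1"
  proof (cases "integrable P (\<lambda>p. f (G p z))")
    case True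
    then have "(\<integral>p. f (G p z) \<partial>P) \<le> (\<integral>p. 1 \<partial>P)"
      using assms by (intro integral_mono) auto
    then show ?thesis by (simp add: step_op_def prob_space)
  qed (simp add: step_op_def not_integrable_integral_eq)
  then show ?thesis
    using assms by (simp add: step_op_def)
qed

lemma step_op_power:
  fixes f :: "'c \<Rightarrow> real"
  assumes "prob_space P" and "case_prod G \<in> P \<Otimes>\<^sub>M C \<rightarrow>\<^sub>M C"
    and "f \<in> borel_measurable C" and "\<And>z. f z \<in> {0..1}"
  shows "(step_op P G ^^ n) f \<in> borel_measurable C" "(step_op P G ^^ n) f z \<in> {0..1}"
proof -
  have "(step_op P G ^^ n) f \<in> borel_measurable C \<and> (\<forall>z. (step_op P G ^^ n) f z \<in> {0..1})"
  proof (induction n)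
    case (Suc n)
    then show ?case
      using step_op_measurable[OF assms(1,2)] step_op_bounds[OF assms(1), of "(step_op P G ^^ n) f"] by simp
  qed (use assms in simp)
  then show "(step_op P G ^^ n) f \<in> borel_measurable C" "(step_op P G ^^ n) f z \<in> {0..1}"
    by auto
qed

text \<open>
  The last step is independent of the earlier ones, so integrating it out replaces \<open>f\<close> by
  \<open>step_op P G f\<close>.
\<close>

lemma expectation_orbit:
  fixes f :: "'c \<Rightarrow> real"
  assumes M: "prob_space M" and P: "prob_space P"
    and G: "case_prod G \<in> P \<Otimes>\<^sub>M C \<rightarrow>\<^sub>M C"
    and Y: "prob_space.indep_vars M (\<lambda>_. P) Y {1..}" "\<And>i. i \<ge> 1 \<Longrightarrow> distr M P (Y i) = P"
    and z: "z \<in> space C" and f: "f \<in> borel_measurable C" "\<And>z. f z \<in> {0..1}"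
  shows "(\<integral>\<omega>. f (orbit G (\<lambda>i. Y i \<omega>) n z) \<partial>M) = (step_op P G ^^ n) f z"
  using f
proof (induction n arbitrary: f)
  case 0
  then show ?case using M by (simp add: prob_space.prob_space)
next
  case (Suc n)
  interpret M: prob_space M by fact
  interpret P: prob_space P by fact
  note [measurable] = Suc.prems(1) G
  have Ym[measurable]: "Y i \<in> M \<rightarrow>\<^sub>M P" if "i \<ge> 1" for i
    using Y(1) that by (auto simp: M.indep_vars_def)
  define A where "A y = orbit G y n z" for y
  define R1 R2 where "R1 \<omega> = restrict (\<lambda>i. Y i \<omega>) {1..n}" and "R2 \<omega> = restrict (\<lambda>i. Y i \<omega>) {Suc n}" for \<omega>
  let ?S1 = "\<Pi>\<^sub>M i\<in>{1..n}. P" and ?S2 = "\<Pi>\<^sub>M i\<in>{Suc n}. P"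
  have [measurable]: "A \<in> ?S1 \<rightarrow>\<^sub>M C"
  proof -
    have "(\<lambda>(y, z). orbit G (\<lambda>i. y i) n z) \<in> ?S1 \<Otimes>\<^sub>M C \<rightarrow>\<^sub>M C"
      by (rule orbit_measurable[OF G, of n "\<lambda>i y. y i"]) measurable
    from measurable_compose[OF measurable_Pair2'[OF z] this] show ?thesis by (simp add: A_def[abs_def])
  qed
  have AR: "A (R1 \<omega>) = orbit G (\<lambda>i. Y i \<omega>) n z" for \<omega>
    by (auto simp: A_def R1_def intro!: orbit_cong)
  have "M.indep_var ?S1 R1 ?S2 R2"
    unfolding R1_def R2_def by (rule M.indep_var_restrict[OF Y(1)]) auto
  then have R[measurable]: "R1 \<in> M \<rightarrow>\<^sub>M ?S1" "R2 \<in> M \<rightarrow>\<^sub>M ?S2"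
    and joint: "distr M ?S1 R1 \<Otimes>\<^sub>M distr M ?S2 R2 = distr M (?S1 \<Otimes>\<^sub>M ?S2) (\<lambda>\<omega>. (R1 \<omega>, R2 \<omega>))"
    using M.indep_var_distribution_eq by auto
  interpret D1: prob_space "distr M ?S1 R1" by (rule M.prob_space_distr) measurable
  interpret D2: prob_space "distr M ?S2 R2" by (rule M.prob_space_distr) measurable
  interpret D: pair_prob_space "distr M ?S1 R1" "distr M ?S2 R2" ..
  have fG[measurable]: "(\<lambda>(w, p). f (G p w)) \<in> borel_measurable (C \<Otimes>\<^sub>M P)"
  proof -
    have "(\<lambda>x. f (case_prod G (snd x, fst x))) \<in> borel_measurable (C \<Otimes>\<^sub>M P)"
      by measurable
    then show ?thesis by (simp add: case_prod_unfold)
  qed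
  define h where "h x = (\<lambda>(w, p). f (G p w)) (A (fst x), snd x (Suc n))" for x
  have h[measurable]: "h \<in> borel_measurable (?S1 \<Otimes>\<^sub>M ?S2)"
    unfolding h_def[abs_def] by measurable
  have inner: "(\<integral>y. h (x, y) \<partial>distr M ?S2 R2) = step_op P G f (A x)" if "x \<in> space ?S1" for x
  proof -
    have "A x \<in> space C" using that by (rule measurable_space[rotated]) measurable
    then have [measurable]: "(\<lambda>p. f (G p (A x))) \<in> borel_measurable P"
      using measurable_compose[OF measurable_Pair1' fG] by simp
    have "(\<integral>y. h (x, y) \<partial>distr M ?S2 R2) = (\<integral>\<omega>. f (G (Y (Suc n) \<omega>) (A x)) \<partial>M)"
      by (subst integral_distr) (auto simp: h_def R2_def)
    also have "\<dots> = (\<integral>p. f (G p (A x)) \<partial>distr M P (Y (Suc n)))"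
      by (subst integral_distr) auto
    finally show ?thesis by (simp add: Y(2) step_op_def)
  qed
  have "(\<integral>\<omega>. f (orbit G (\<lambda>i. Y i \<omega>) (Suc n) z) \<partial>M) = (\<integral>\<omega>. h (R1 \<omega>, R2 \<omega>) \<partial>M)"
    by (simp add: h_def AR) (simp add: R2_def)
  also have "\<dots> = (\<integral>x. h x \<partial>(distr M ?S1 R1 \<Otimes>\<^sub>M distr M ?S2 R2))"
    unfolding joint by (subst integral_distr[OF measurable_Pair[OF R] h]) (rule refl)
  also have "\<dots> = (\<integral>x. (\<integral>y. h (x, y) \<partial>distr M ?S2 R2) \<partial>distr M ?S1 R1)"
  proof (rule D.integral_fst'[symmetric], rule D.P.integrable_const_bound[where B = 1])
    show "AE x in distr M ?S1 R1 \<Otimes>\<^sub>M distr M ?S2 R2. norm (h x) \<le> 1"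
      using Suc.prems(2) by (auto simp: h_def)
  qed measurable
  also have "\<dots> = (\<integral>x. step_op P G f (A x) \<partial>distr M ?S1 R1)"
    by (intro Bochner_Integration.integral_cong) (auto simp: inner)
  also have "\<dots> = (\<integral>\<omega>. step_op P G f (A (R1 \<omega>)) \<partial>M)"
    by (rule integral_distr[OF R(1)], rule measurable_compose[OF _ step_op_measurable[OF P G Suc.prems(1)]])
      measurable
  also have "\<dots> = (step_op P G ^^ n) (step_op P G f) z"
    unfolding AR
    by (rule Suc.IH[OF step_op_measurable[OF P G Suc.prems(1)] step_op_bounds[OF P Suc.prems(2)]])
  finally show ?case
    by (simp add: funpow_swap1)
qed

text \<open>
  The expected area of the part of \<open>B\<close> that returns to \<open>B\<close> at time \<open>n\<close> is the inner product of the
  indicator of \<open>B\<close> with its image under the \<open>n\<close>-th power of the transition operator. It decays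
  geometrically, so almost surely the areas are summable.
\<close>

lemma escape_of_L2_contraction:
  fixes G :: "'p \<Rightarrow> 'c :: euclidean_space \<Rightarrow> 'c" and \<rho> :: real
  assumes M: "prob_space M" and P: "prob_space P"
    and G: "case_prod G \<in> P \<Otimes>\<^sub>M borel \<rightarrow>\<^sub>M borel"
    and Y: "prob_space.indep_vars M (\<lambda>_. P) Y {1..}" "\<And>i. i \<ge> 1 \<Longrightarrow> distr M P (Y i) = P"
    and \<rho>: "0 < \<rho>" "\<rho> < 1"
    and contr: "\<And>f :: 'c \<Rightarrow> real. f \<in> borel_measurable borel \<Longrightarrow> (\<And>z. f z \<in> {0..1}) \<Longrightarrow>
      (\<integral>\<^sup>+z. ennreal ((f z)\<^sup>2) \<partial>lborel) < \<infinity> \<Longrightarrow>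
      (\<integral>\<^sup>+z. ennreal ((step_op P G f z)\<^sup>2) \<partial>lborel) \<le> ennreal \<rho> * (\<integral>\<^sup>+z. ennreal ((f z)\<^sup>2) \<partial>lborel)"
    and B: "B \<in> sets borel" "emeasure lborel B < \<infinity>"
  shows "AE \<omega> in M. (\<lambda>n. measure lborel {z \<in> B. orbit G (\<lambda>i. Y i \<omega>) n z \<in> B}) \<longlonglongrightarrow> 0"
proof -
  interpret M: prob_space M by fact
  interpret MB: pair_sigma_finite M "lborel :: 'c measure" ..
  note [measurable] = B(1)
  have Ym: "Y i \<in> M \<rightarrow>\<^sub>M P" if "i \<ge> 1" for i
    using Y(1) that by (auto simp: M.indep_vars_def)
  have orb[measurable]: "(\<lambda>(\<omega>, z). orbit G (\<lambda>i. Y i \<omega>) n z) \<in> M \<Otimes>\<^sub>M borel \<rightarrow>\<^sub>M borel" for n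
    by (rule orbit_measurable[OF G]) (auto intro: Ym)
  define f :: "'c \<Rightarrow> real" where "f = indicator B"
  have f[measurable]: "f \<in> borel_measurable borel" and f01: "f z \<in> {0..1}" for z
    by (auto simp: f_def indicator_def)
  define V where "V = emeasure lborel B"
  define u where "u n = (step_op P G ^^ n) f" for n
  have u[measurable]: "u n \<in> borel_measurable borel" and u01: "u n z \<in> {0..1}" for n z
    unfolding u_def by (intro step_op_power[where C = borel] P G f f01)+
  have fV: "(\<integral>\<^sup>+z. ennreal ((f z)\<^sup>2) \<partial>lborel) = V"
  proof -
    have "(\<integral>\<^sup>+z. ennreal ((f z)\<^sup>2) \<partial>lborel) = (\<integral>\<^sup>+z. indicator B z \<partial>lborel)"
      by (intro nn_integral_cong) (auto simp: f_def indicator_def)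
    then show ?thesis by (simp add: V_def)
  qed
  have u2: "(\<integral>\<^sup>+z. ennreal ((u n z)\<^sup>2) \<partial>lborel) \<le> ennreal (\<rho> ^ n) * V" for n
  proof (induction n)
    case 0
    then show ?case by (simp add: u_def fV)
  next
    case (Suc n)
    have "(\<integral>\<^sup>+z. ennreal ((u n z)\<^sup>2) \<partial>lborel) < \<infinity>"
      using Suc B(2) by (auto simp: V_def less_top[symmetric] top_unique ennreal_mult_eq_top_iff)
    from contr[OF u u01 this] have "(\<integral>\<^sup>+z. ennreal ((u (Suc n) z)\<^sup>2) \<partial>lborel)
        \<le> ennreal \<rho> * (\<integral>\<^sup>+z. ennreal ((u n z)\<^sup>2) \<partial>lborel)"
      by (simp add: u_def)
    also have "\<dots> \<le> ennreal \<rho> * (ennreal (\<rho> ^ n) * V)"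
      by (intro mult_left_mono Suc) auto
    finally show ?case using \<rho> by (simp add: ennreal_mult mult_ac)
  qed
  define F where "F n \<omega> = emeasure lborel {z \<in> B. orbit G (\<lambda>i. Y i \<omega>) n z \<in> B}" for n \<omega>
  have F: "F n \<omega> = (\<integral>\<^sup>+z. indicator B z * ennreal (f (orbit G (\<lambda>i. Y i \<omega>) n z)) \<partial>lborel)"
    if "\<omega> \<in> space M" for n \<omega>
  proof -
    have [measurable]: "(\<lambda>z. orbit G (\<lambda>i. Y i \<omega>) n z) \<in> borel \<rightarrow>\<^sub>M borel"
      using measurable_compose[OF measurable_Pair1'[OF that] orb[of n]] by simp
    have "F n \<omega> = (\<integral>\<^sup>+z. indicator {z \<in> B. orbit G (\<lambda>i. Y i \<omega>) n z \<in> B} z \<partial>lborel)"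
      unfolding F_def by (rule nn_integral_indicator[symmetric]) simp
    also have "\<dots> = (\<integral>\<^sup>+z. indicator B z * ennreal (f (orbit G (\<lambda>i. Y i \<omega>) n z)) \<partial>lborel)"
      by (intro nn_integral_cong) (auto simp: f_def indicator_def)
    finally show ?thesis .
  qed
  define l where "l = sqrt \<rho>"
  have l: "0 < l" "l < 1" "l * l = \<rho>" using \<rho> by (auto simp: l_def)
  have EF: "(\<integral>\<^sup>+\<omega>. F n \<omega> \<partial>M) \<le> ennreal (l ^ n) * (2 * V)" for n
  proof -
    have "(\<integral>\<^sup>+\<omega>. F n \<omega> \<partial>M)
        = (\<integral>\<^sup>+\<omega>. (\<integral>\<^sup>+z. indicator B z * ennreal (f (orbit G (\<lambda>i. Y i \<omega>) n z)) \<partial>lborel) \<partial>M)"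
      by (intro nn_integral_cong F)
    also have "\<dots> = (\<integral>\<^sup>+z. (\<integral>\<^sup>+\<omega>. indicator B z * ennreal (f (orbit G (\<lambda>i. Y i \<omega>) n z)) \<partial>M) \<partial>lborel)"
      by (rule MB.Fubini'[symmetric]) simp
    also have "\<dots> = (\<integral>\<^sup>+z. indicator B z * ennreal (u n z) \<partial>lborel)"
    proof (rule nn_integral_cong)
      fix z :: 'c
      have [measurable]: "(\<lambda>\<omega>. orbit G (\<lambda>i. Y i \<omega>) n z) \<in> borel_measurable M"
        using measurable_compose[OF measurable_Pair2' orb[of n]] by simp
      have "(\<integral>\<^sup>+\<omega>. ennreal (f (orbit G (\<lambda>i. Y i \<omega>) n z)) \<partial>M)
          = ennreal (\<integral>\<omega>. f (orbit G (\<lambda>i. Y i \<omega>) n z) \<partial>M)"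
        using f01 by (intro nn_integral_eq_integral M.integrable_const_bound[where B = 1]) auto
      also have "(\<integral>\<omega>. f (orbit G (\<lambda>i. Y i \<omega>) n z) \<partial>M) = u n z"
        unfolding u_def by (rule expectation_orbit[OF M P G Y]) (use f f01 in auto)
      finally show "(\<integral>\<^sup>+\<omega>. indicator B z * ennreal (f (orbit G (\<lambda>i. Y i \<omega>) n z)) \<partial>M)
          = indicator B z * ennreal (u n z)"
        by (simp add: nn_integral_cmult)
    qed
    also have "\<dots> \<le> (\<integral>\<^sup>+z. ennreal (l ^ n) * indicator B z + ennreal (1 / l ^ n) * ennreal ((u n z)\<^sup>2) \<partial>lborel)"
    proof (rule nn_integral_mono)
      fix z :: 'c
      have ln: "l ^ n > 0" using l by simp
      \<comment> \<open>The weight \<open>l ^ n\<close> balances the two terms, as \<open>l ^ n * l ^ n = \<rho> ^ n\<close>.\<close>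
      have "0 \<le> (l ^ n - u n z)\<^sup>2 + l ^ n * u n z"
        using u01[of n z] ln by (intro add_nonneg_nonneg) auto
      then have "u n z * l ^ n \<le> l ^ n * l ^ n + (u n z)\<^sup>2"
        by (simp add: power2_eq_square algebra_simps)
      then have "u n z \<le> (l ^ n * l ^ n + (u n z)\<^sup>2) / l ^ n"
        using ln by (simp add: pos_le_divide_eq)
      also have "\<dots> = l ^ n + 1 / l ^ n * (u n z)\<^sup>2"
        using ln by (simp add: add_divide_distrib)
      finally have "u n z \<le> l ^ n + 1 / l ^ n * (u n z)\<^sup>2" .
      then have "ennreal (u n z) \<le> ennreal (l ^ n + 1 / l ^ n * (u n z)\<^sup>2)"
        by (rule ennreal_leI)
      also have "\<dots> = ennreal (l ^ n) + ennreal (1 / l ^ n) * ennreal ((u n z)\<^sup>2)"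
        using ln by (simp add: ennreal_plus ennreal_mult' flip: ennreal_mult')
      finally show "indicator B z * ennreal (u n z)
          \<le> ennreal (l ^ n) * indicator B z + ennreal (1 / l ^ n) * ennreal ((u n z)\<^sup>2)"
        by (auto simp: indicator_def)
    qed
    also have "\<dots> = ennreal (l ^ n) * V + ennreal (1 / l ^ n) * (\<integral>\<^sup>+z. ennreal ((u n z)\<^sup>2) \<partial>lborel)"
      by (subst nn_integral_add) (auto simp: nn_integral_cmult V_def)
    also have "\<dots> \<le> ennreal (l ^ n) * V + ennreal (1 / l ^ n) * (ennreal (\<rho> ^ n) * V)"
      by (intro add_left_mono mult_left_mono u2) auto
    also have "ennreal (1 / l ^ n) * (ennreal (\<rho> ^ n) * V) = ennreal (l ^ n) * V"
      using l by (simp add: ennreal_mult'[symmetric] mult.assoc[symmetric] power_mult_distrib flip: l(3))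
    finally show ?thesis
      by (simp add: mult.assoc mult.left_commute flip: mult_2)
  qed
  have Fm[measurable]: "F n \<in> borel_measurable M" for n
  proof -
    have "(\<lambda>\<omega>. \<integral>\<^sup>+z. indicator B z * ennreal (f (orbit G (\<lambda>i. Y i \<omega>) n z)) \<partial>lborel) \<in> borel_measurable M"
      by measurable
    then show ?thesis by (subst measurable_cong[OF F])
  qed
  have "(\<integral>\<^sup>+\<omega>. (\<Sum>n. F n \<omega>) \<partial>M) = (\<Sum>n. \<integral>\<^sup>+\<omega>. F n \<omega> \<partial>M)"
    by (rule nn_integral_suminf) measurable
  also have "\<dots> \<le> (\<Sum>n. ennreal (l ^ n) * (2 * V))"
    by (intro suminf_le EF) auto
  also have "\<dots> = (\<Sum>n. ennreal (l ^ n)) * (2 * V)"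
    by simp
  also have "(\<Sum>n. ennreal (l ^ n)) = ennreal (\<Sum>n. l ^ n)"
    using l by (intro suminf_ennreal2 summable_geometric) auto
  also have "\<dots> * (2 * V) < \<infinity>"
    using B(2) by (auto simp: V_def ennreal_mult_less_top)
  finally have "(\<integral>\<^sup>+\<omega>. (\<Sum>n. F n \<omega>) \<partial>M) \<noteq> \<infinity>" by simp
  then have "AE \<omega> in M. (\<Sum>n. F n \<omega>) \<noteq> \<infinity>"
    by (intro nn_integral_PInf_AE) measurable
  then show ?thesis
  proof (rule eventually_mono)
    fix \<omega> assume "(\<Sum>n. F n \<omega>) \<noteq> \<infinity>"
    moreover have "F n \<omega> = ennreal (measure lborel {z \<in> B. orbit G (\<lambda>i. Y i \<omega>) n z \<in> B})" for n
    proof -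
      have "F n \<omega> \<le> emeasure lborel B"
        unfolding F_def by (rule emeasure_mono) (auto simp: B)
      then show ?thesis
        unfolding F_def using B(2) by (intro emeasure_eq_ennreal_measure) (auto simp: top_unique)
    qed
    ultimately have "summable (\<lambda>n. measure lborel {z \<in> B. orbit G (\<lambda>i. Y i \<omega>) n z \<in> B})"
      by (intro summable_suminf_not_top) auto
    then show "(\<lambda>n. measure lborel {z \<in> B. orbit G (\<lambda>i. Y i \<omega>) n z \<in> B}) \<longlonglongrightarrow> 0"
      by (rule summable_LIMSEQ_zero)
  qed
qed

section \<open>Subdivision as a random walk on the plane\<close>

text \<open>
  A triple of reals modulo constants is a point of a plane; this coordinate is the discrete Fourier
  coefficient of the triple, and it diagonalises the cyclic relabelling of the vertices.
\<close>

definition triple_coord :: "(nat \<Rightarrow> real) \<Rightarrow> complex" where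
  "triple_coord x = rot3 * of_real (x 1) + rot3\<^sup>2 * of_real (x 2) + of_real (x 3)"

definition mean_coeff :: "(nat \<Rightarrow> real) \<Rightarrow> complex" where
  "mean_coeff t = 1 - (1 - rot3\<^sup>2) / 3 * of_real (t 1 + t 2 + t 3)"

definition dev_coeff :: "(nat \<Rightarrow> real) \<Rightarrow> complex" where
  "dev_coeff t = (rot3 - 1) / 3 * (rot3\<^sup>2 * of_real (t 1) + rot3 * of_real (t 2) + of_real (t 3))"

text \<open>
  The factor by which a subdivision with ratios \<open>t\<close> changes the area of a triangle.
\<close>

definition area_factor :: "(nat \<Rightarrow> real) \<Rightarrow> real" where
  "area_factor t = t 1 * t 2 * t 3 + (1 - t 1) * (1 - t 2) * (1 - t 3)"

lemma triple_coord_Complex: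
  "triple_coord x = Complex (x 3 - (x 1 + x 2) / 2) (sqrt 3 / 2 * (x 1 - x 2))"
  unfolding triple_coord_def rot3(3) by (simp add: complex_eq_iff rot3 field_simps)

lemma mean_coeff_Complex:
  "mean_coeff t = Complex (1 - (t 1 + t 2 + t 3) / 2) (- (sqrt 3 / 6 * (t 1 + t 2 + t 3)))"
  unfolding mean_coeff_def rot3(3) by (simp add: complex_eq_iff rot3 field_simps)

lemma norm_dev_coeff:
  "(cmod (dev_coeff t))\<^sup>2 = ((t 3 - (t 1 + t 2) / 2)\<^sup>2 + 3 / 4 * (t 2 - t 1)\<^sup>2) / 3"
proof -
  have "rot3\<^sup>2 * of_real (t 1) + rot3 * of_real (t 2) + of_real (t 3)
      = Complex (t 3 - (t 1 + t 2) / 2) (sqrt 3 / 2 * (t 2 - t 1))"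
    unfolding rot3(3) by (auto simp: complex_eq_iff rot3 field_simps)
  moreover have "(rot3 - 1) / 3 = Complex (- 1 / 2) (sqrt 3 / 6)"
    by (auto simp: complex_eq_iff rot3)
  moreover have "(cmod (Complex (- 1 / 2) (sqrt 3 / 6)))\<^sup>2 = 1 / 3"
    by (simp add: cmod_power2 power_divide)
  ultimately show ?thesis
    unfolding dev_coeff_def
    by (simp add: norm_mult power_mult_distrib cmod_power2 power_divide)
qed

lemma coeff_norms: "(cmod (mean_coeff t))\<^sup>2 - (cmod (dev_coeff t))\<^sup>2 = area_factor t"
proof -
  define T where "T = t 1 + t 2 + t 3"
  have "(cmod (mean_coeff t))\<^sup>2 = (1 - T / 2)\<^sup>2 + T\<^sup>2 / 12"
    by (simp add: mean_coeff_Complex T_def[symmetric] cmod_power2 power_mult_distrib power_divide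
        del: One_nat_def)
  then show ?thesis
    unfolding norm_dev_coeff area_factor_def T_def
    by (simp add: power2_eq_square field_simps)
qed

lemma dev_coeff_eq_0: "dev_coeff t = 0 \<Longrightarrow> t 1 = t 2"
proof -
  assume "dev_coeff t = 0"
  then have "(t 3 - (t 1 + t 2) / 2)\<^sup>2 + 3 / 4 * (t 2 - t 1)\<^sup>2 = 0"
    using norm_dev_coeff[of t] by simp
  moreover have "0 \<le> (t 3 - (t 1 + t 2) / 2)\<^sup>2" by simp
  ultimately have "(t 2 - t 1)\<^sup>2 \<le> 0" by linarith
  then show "t 1 = t 2" by simp
qed

lemma area_factor_pos:
  assumes "\<And>i. i \<in> {1..3} \<Longrightarrow> t i \<in> {0<..<1}"
  shows "area_factor t > 0"
  unfolding area_factor_def using assms[of 1] assms[of 2] assms[of 3]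
  by (intro add_pos_pos mult_pos_pos) auto

lemma dev_less_mean:
  assumes "\<And>i. i \<in> {1..3} \<Longrightarrow> t i \<in> {0<..<1}"
  shows "cmod (dev_coeff t) < cmod (mean_coeff t)"
proof (rule power2_less_imp_less)
  show "(cmod (dev_coeff t))\<^sup>2 < (cmod (mean_coeff t))\<^sup>2"
    using coeff_norms[of t] area_factor_pos[of t] assms by auto
qed simp

definition step :: "(nat \<Rightarrow> real) \<Rightarrow> complex \<Rightarrow> complex" where
  "step t = stretch (mean_coeff t) (dev_coeff t)"

text \<open>
  One coordinate of the three vertices evolves by the real-linear map with coefficients
  \<open>mean_coeff t\<close> and \<open>dev_coeff t\<close>: the first depends on the mean of the ratios only, the second
  vanishes when the three ratios agree.
\<close>

lemma triple_coord_subdivide: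
  fixes x t :: "nat \<Rightarrow> real"
  shows "triple_coord (\<lambda>j. x j + t j * (x (cyc_next 3 j) - x j))
    = mean_coeff t * triple_coord x + dev_coeff t * cnj (triple_coord x)"
proof -
  have c: "cyc_next 3 1 = 2" "cyc_next 3 2 = 3" "cyc_next 3 3 = 1" by (auto simp: cyc_next_def)
  have s: "sqrt 3 * (sqrt 3 * y) = 3 * y" for y
    by (simp flip: mult.assoc)
  have "dev_coeff t = Complex (- 1 / 2) (sqrt 3 / 6)
      * Complex (t 3 - (t 1 + t 2) / 2) (sqrt 3 / 2 * (t 2 - t 1))"
    unfolding dev_coeff_def rot3(3) by (simp add: complex_eq_iff rot3 field_simps)
  then show ?thesis
    by (simp only: c triple_coord_Complex mean_coeff_Complex) (simp add: complex_eq_iff field_simps s)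
qed

definition cyc_shift :: "(nat \<Rightarrow> real) \<Rightarrow> nat \<Rightarrow> real" where
  "cyc_shift t = (\<lambda>j\<in>{1..3}. t (cyc_next 3 j))"

text \<open>
  A cyclic relabelling of independent ratios with a common distribution does not change their joint
  law, so the three maps of \<open>three_stretch_contraction\<close> are equally likely steps.
\<close>

lemma coeffs_cyc_shift:
  "mean_coeff (cyc_shift t) = mean_coeff t" "dev_coeff (cyc_shift t) = rot3 * dev_coeff t"
proof -
  have c: "cyc_shift t 1 = t 2" "cyc_shift t 2 = t 3" "cyc_shift t 3 = t 1"
    by (simp_all add: cyc_next_def cyc_shift_def numeral_2_eq_2 numeral_3_eq_3)
  have sum: "t 2 + t 3 + t 1 = t 1 + t 2 + t 3" by simp
  show "mean_coeff (cyc_shift t) = mean_coeff t"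
    unfolding mean_coeff_def c sum ..
  have "rot3 * (rot3\<^sup>2 * of_real (t 1) + rot3 * of_real (t 2) + of_real (t 3))
     = rot3 ^ 3 * of_real (t 1) + rot3\<^sup>2 * of_real (t 2) + rot3 * of_real (t 3)"
    by (simp add: algebra_simps power2_eq_square power3_eq_cube)
  then have "rot3\<^sup>2 * of_real (t 2) + rot3 * of_real (t 3) + of_real (t 1)
     = rot3 * (rot3\<^sup>2 * of_real (t 1) + rot3 * of_real (t 2) + of_real (t 3))"
    by (simp add: rot3(2))
  then show "dev_coeff (cyc_shift t) = rot3 * dev_coeff t"
    unfolding dev_coeff_def c by simp
qed

section \<open>The transition operator of the subdivision\<close>

lemma (in prob_space) square_expectation_le:
  fixes X :: "'a \<Rightarrow> real"
  assumes "integrable M X" "integrable M (\<lambda>x. (X x)\<^sup>2)"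
  shows "(expectation X)\<^sup>2 \<le> expectation (\<lambda>x. (X x)\<^sup>2)"
  using variance_positive[of X] variance_eq[OF assms] by simp

context
  fixes \<mu> :: "real measure" and P :: "(nat \<Rightarrow> real) measure"
  assumes prob: "prob_space \<mu>" and sets_\<mu>[measurable_cong]: "sets \<mu> = sets borel"
    and unit: "AE x in \<mu>. x \<in> {0<..<1}"
  defines "P \<equiv> \<Pi>\<^sub>M i\<in>{1..3::nat}. \<mu>"
begin

interpretation \<mu>: prob_space \<mu> by (rule prob)
interpretation PP: product_prob_space "\<lambda>_. \<mu>" "{1..3::nat}" ..
interpretation P: prob_space P unfolding P_def by (rule prob_space_PiM) (rule prob)

lemma component_measurable: "i \<in> {1..3} \<Longrightarrow> (\<lambda>t. t i) \<in> borel_measurable P"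
  unfolding P_def using measurable_component_singleton[of i "{1..3}" "\<lambda>_. \<mu>"]
  by (simp add: measurable_cong_sets[OF refl sets_\<mu>])

lemma step_measurable: "case_prod step \<in> P \<Otimes>\<^sub>M borel \<rightarrow>\<^sub>M borel"
proof -
  have [measurable]: "(\<lambda>t. t 1) \<in> borel_measurable P" "(\<lambda>t. t 2) \<in> borel_measurable P" "(\<lambda>t. t 3) \<in> borel_measurable P"
    by (auto intro!: component_measurable)
  have [measurable]: "cnj \<in> borel_measurable borel"
    by (intro borel_measurable_continuous_onI continuous_intros)
  show ?thesis
    unfolding step_def stretch_def mean_coeff_def dev_coeff_def by measurable
qed

lemma coeff_measurable [measurable]:
  "mean_coeff \<in> borel_measurable P" "dev_coeff \<in> borel_measurable P"
proof -
  have [measurable]: "(\<lambda>t. t 1) \<in> borel_measurable P" "(\<lambda>t. t 2) \<in> borel_measurable P" "(\<lambda>t. t 3) \<in> borel_measurable P"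
    by (auto intro!: component_measurable)
  show "mean_coeff \<in> borel_measurable P" "dev_coeff \<in> borel_measurable P"
    unfolding mean_coeff_def[abs_def] dev_coeff_def[abs_def] by measurable
qed

lemma distr_cyc_shift: "distr P P cyc_shift = P"
proof -
  have "inj_on (cyc_next 3) {1..3}" "cyc_next 3 \<in> {1..3} \<rightarrow> {1..3}"
    by (auto simp: inj_on_def cyc_next_def)
  from distr_PiM_reindex[OF _ this, of "\<lambda>_. \<mu>"] show ?thesis
    using prob by (simp add: P_def cyc_shift_def[abs_def])
qed

lemma cyc_shift_measurable: "cyc_shift \<in> P \<rightarrow>\<^sub>M P"
  unfolding P_def cyc_shift_def
  by (intro measurable_restrict measurable_component_singleton) (auto simp: cyc_next_def)

lemma step_op_rotate:
  fixes f :: "complex \<Rightarrow> real"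
  assumes [measurable]: "f \<in> borel_measurable borel"
  shows "step_op P step f z = (\<integral>t. f (stretch (mean_coeff t) (rot3 ^ k * dev_coeff t) z) \<partial>P)"
proof -
  have m: "(\<lambda>t. f (stretch (mean_coeff t) (rot3 ^ k * dev_coeff t) z)) \<in> borel_measurable P" for k
    unfolding stretch_def by measurable
  show ?thesis
  proof (induction k)
    case 0
    then show ?case by (simp add: step_op_def step_def)
  next
    case (Suc k)
    have "(\<integral>t. f (stretch (mean_coeff t) (rot3 ^ k * dev_coeff t) z) \<partial>P)
       = (\<integral>t. f (stretch (mean_coeff t) (rot3 ^ k * dev_coeff t) z) \<partial>distr P P cyc_shift)"
      by (simp add: distr_cyc_shift)
    also have "\<dots> = (\<integral>t. f (stretch (mean_coeff t) (rot3 ^ Suc k * dev_coeff t) z) \<partial>P)"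
      by (subst integral_distr[OF cyc_shift_measurable m]) (simp add: coeffs_cyc_shift mult_ac)
    finally show ?case using Suc by simp
  qed
qed

definition rate :: ennreal where
  "rate = (\<integral>\<^sup>+t. ennreal (1 - gap (mean_coeff t) (dev_coeff t)) \<partial>P)"

lemma AE_dev_less_mean: "AE t in P. cmod (dev_coeff t) < cmod (mean_coeff t)"
proof -
  have "AE t in P. \<forall>i\<in>{1..3}. t i \<in> {0<..<1}"
    unfolding P_def using unit prob by (intro eventually_ball_finite ballI AE_PiM_component) auto
  then show ?thesis
    by (rule eventually_mono) (auto intro!: dev_less_mean)
qed

text \<open>
  By the cyclic symmetry of the law, \<open>step_op P step f\<close> is also the expectation of the average \<open>S t\<close>
  of \<open>f\<close> along the three maps obtained from \<open>t\<close>. Jensen's inequality bounds its square by the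
  expectation of \<open>(S t)\<^sup>2\<close>, and \<open>three_stretch_contraction\<close> applies for each \<open>t\<close>. Ratios near \<open>0\<close> or
  \<open>1\<close>, where the maps are badly distorted and the gap degenerates, do no harm: they contribute at
  most the factor \<open>1\<close>.
\<close>

lemma step_op_contraction:
  fixes f :: "complex \<Rightarrow> real"
  assumes f[measurable]: "f \<in> borel_measurable borel" and f01: "\<And>z. f z \<in> {0..1}"
    and f2: "(\<integral>\<^sup>+z. ennreal ((f z)\<^sup>2) \<partial>lborel) < \<infinity>"
  shows "(\<integral>\<^sup>+z. ennreal ((step_op P step f z)\<^sup>2) \<partial>lborel) \<le> rate * (\<integral>\<^sup>+z. ennreal ((f z)\<^sup>2) \<partial>lborel)"
proof -
  interpret PL: pair_sigma_finite P "lborel :: complex measure" ..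
  have f2i: "integrable lborel (\<lambda>z. (f z)\<^sup>2)"
    using f2 by (intro integrableI_nonneg) auto
  define h where "h k t z = f (stretch (mean_coeff t) (rot3 ^ k * dev_coeff t) z)" for k t z
  define S where "S t z = (h 0 t z + h 1 t z + h 2 t z) / 3" for t z
  have [measurable]: "cnj \<in> borel_measurable borel"
    by (intro borel_measurable_continuous_onI continuous_intros)
  have hm[measurable]: "(\<lambda>(t, z). h k t z) \<in> borel_measurable (P \<Otimes>\<^sub>M borel)" for k
    unfolding h_def stretch_def by measurable
  have [measurable]: "(\<lambda>(t, z). S t z) \<in> borel_measurable (P \<Otimes>\<^sub>M borel)"
    unfolding S_def by measurable
  have hm1[measurable]: "(\<lambda>t. h k t z) \<in> borel_measurable P" for k z
    unfolding h_def stretch_def by measurable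
  have h01: "h k t z \<in> {0..1}" for k t z
    unfolding h_def by (rule f01)
  have hi: "integrable P (\<lambda>t. h k t z)" for k z
    using h01 by (intro P.integrable_const_bound[where B = 1] hm1) auto
  have [measurable]: "(\<lambda>t. S t z) \<in> borel_measurable P" for z
    unfolding S_def by measurable
  have S01: "S t z \<in> {0..1}" for t z
    using h01[of 0 t z] h01[of 1 t z] h01[of 2 t z] by (auto simp: S_def)
  have le: "(step_op P step f z)\<^sup>2 \<le> (\<integral>t. (S t z)\<^sup>2 \<partial>P)" for z
  proof -
    have "step_op P step f z = (\<integral>t. S t z \<partial>P)"
    proof -
      have "(\<integral>t. h k t z \<partial>P) = step_op P step f z" for k
        unfolding h_def by (rule step_op_rotate[OF f, symmetric])
      then show ?thesis using hi by (simp add: S_def)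
    qed
    also have "\<dots>\<^sup>2 \<le> (\<integral>t. (S t z)\<^sup>2 \<partial>P)"
      using S01[of _ z] by (intro P.square_expectation_le P.integrable_const_bound[where B = 1])
        (auto simp: power_le_one)
    finally show ?thesis .
  qed
  have "(\<integral>\<^sup>+z. ennreal ((step_op P step f z)\<^sup>2) \<partial>lborel) \<le> (\<integral>\<^sup>+z. (\<integral>\<^sup>+t. ennreal ((S t z)\<^sup>2) \<partial>P) \<partial>lborel)"
  proof (rule nn_integral_mono)
    fix z :: complex
    have "(\<integral>\<^sup>+t. ennreal ((S t z)\<^sup>2) \<partial>P) = ennreal (\<integral>t. (S t z)\<^sup>2 \<partial>P)"
      using S01[of _ z] by (intro nn_integral_eq_integral P.integrable_const_bound[where B = 1])
        (auto simp: power_le_one)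
    then show "ennreal ((step_op P step f z)\<^sup>2) \<le> (\<integral>\<^sup>+t. ennreal ((S t z)\<^sup>2) \<partial>P)"
      using le[of z] by (simp add: ennreal_leI)
  qed
  also have "\<dots> = (\<integral>\<^sup>+t. (\<integral>\<^sup>+z. ennreal ((S t z)\<^sup>2) \<partial>lborel) \<partial>P)"
    by (rule PL.Fubini') measurable
  also have "\<dots> \<le> (\<integral>\<^sup>+t. ennreal (1 - gap (mean_coeff t) (dev_coeff t)) * (\<integral>\<^sup>+z. ennreal ((f z)\<^sup>2) \<partial>lborel) \<partial>P)"
  proof (rule nn_integral_mono_AE, rule eventually_mono[OF AE_dev_less_mean])
    fix t assume t: "cmod (dev_coeff t) < cmod (mean_coeff t)"
    note * = three_stretch_contraction[OF t f f2i, folded h_def, folded S_def]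
    have "(\<integral>\<^sup>+z. ennreal ((S t z)\<^sup>2) \<partial>lborel) = ennreal (\<integral>z. (S t z)\<^sup>2 \<partial>lborel)"
      using *(1) by (intro nn_integral_eq_integral) auto
    also have "\<dots> \<le> ennreal ((1 - gap (mean_coeff t) (dev_coeff t)) * (\<integral>z. (f z)\<^sup>2 \<partial>lborel))"
      using *(2) by (rule ennreal_leI)
    also have "\<dots> = ennreal (1 - gap (mean_coeff t) (dev_coeff t)) * ennreal (\<integral>z. (f z)\<^sup>2 \<partial>lborel)"
      by (rule ennreal_mult'') simp
    also have "ennreal (\<integral>z. (f z)\<^sup>2 \<partial>lborel) = (\<integral>\<^sup>+z. ennreal ((f z)\<^sup>2) \<partial>lborel)"
      using f2i by (intro nn_integral_eq_integral[symmetric]) auto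
    finally show "(\<integral>\<^sup>+z. ennreal ((S t z)\<^sup>2) \<partial>lborel)
        \<le> ennreal (1 - gap (mean_coeff t) (dev_coeff t)) * (\<integral>\<^sup>+z. ennreal ((f z)\<^sup>2) \<partial>lborel)" .
  qed
  also have "\<dots> = rate * (\<integral>\<^sup>+z. ennreal ((f z)\<^sup>2) \<partial>lborel)"
    unfolding rate_def gap_def growth_def spread_def by (rule nn_integral_multc) measurable
  finally show ?thesis .
qed

text \<open>
  The gap vanishes only when \<open>dev_coeff t = 0\<close>, which forces \<open>t 1 = t 2\<close>; that fails whenever
  \<open>t 1\<close> lies in \<open>U\<close> and \<open>t 2\<close> in \<open>V\<close>.
\<close>

lemma rate_less_1:
  assumes "U \<in> sets borel" "V \<in> sets borel" "U \<inter> V = {}" "emeasure \<mu> U > 0" "emeasure \<mu> V > 0"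
  shows "rate < 1"
proof -
  have "rate < (\<integral>\<^sup>+t. 1 \<partial>P)"
    unfolding rate_def
  proof (rule nn_integral_less)
    have gap0: "gap a b \<ge> 0" for a b
      by (simp add: gap_def)
    have "(\<integral>\<^sup>+t. ennreal (1 - gap (mean_coeff t) (dev_coeff t)) \<partial>P) \<le> (\<integral>\<^sup>+t. 1 \<partial>P)"
      using gap0 by (intro nn_integral_mono) (auto simp: ennreal_le_1)
    then show "(\<integral>\<^sup>+t. ennreal (1 - gap (mean_coeff t) (dev_coeff t)) \<partial>P) \<noteq> \<infinity>"
      by (auto simp: P.emeasure_space_1 top_unique)
    show "AE t in P. ennreal (1 - gap (mean_coeff t) (dev_coeff t)) \<le> 1"
      using gap0 by (auto simp: ennreal_le_1)
    show "\<not> (AE t in P. 1 \<le> ennreal (1 - gap (mean_coeff t) (dev_coeff t)))"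
    proof
      assume "AE t in P. 1 \<le> ennreal (1 - gap (mean_coeff t) (dev_coeff t))"
      with AE_dev_less_mean have eq: "AE t in P. t 1 = t 2"
      proof eventually_elim
        case (elim t)
        then have "gap (mean_coeff t) (dev_coeff t) \<le> 0"
          by (simp add: ennreal_ge_1)
        moreover have "gap (mean_coeff t) (dev_coeff t) > 0" if "dev_coeff t \<noteq> 0"
          using growth_pos[OF elim(1) that] spread_pos[OF elim(1) that] by (simp add: gap_def)
        ultimately have "dev_coeff t = 0" by fastforce
        then show ?case by (rule dev_coeff_eq_0)
      qed
      define A where "A i = (if i = 1 then U else if i = 2 then V else space \<mu>)" for i :: nat
      have A: "A i \<in> sets \<mu>" for i
      proof -
        have "U \<in> sets \<mu>" "V \<in> sets \<mu>" using assms by (simp_all add: sets_\<mu>)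
        then show ?thesis by (simp add: A_def)
      qed
      have "emeasure P (Pi\<^sub>E {1..3} A) = (\<Prod>i\<in>{1..3}. emeasure \<mu> (A i))"
        unfolding P_def by (rule PP.emeasure_PiM) (auto intro: A)
      also have "\<dots> = emeasure \<mu> U * emeasure \<mu> V"
        by (simp add: A_def numeral_3_eq_3 numeral_2_eq_2 \<mu>.emeasure_space_1)
      finally have "emeasure P (Pi\<^sub>E {1..3} A) > 0"
        using assms by (simp add: ennreal_zero_less_mult_iff)
      moreover have "emeasure P (Pi\<^sub>E {1..3} A) = 0"
      proof -
        have "AE t in P. t \<notin> Pi\<^sub>E {1..3} A"
          using eq
        proof (rule eventually_mono)
          fix t :: "nat \<Rightarrow> real" assume t: "t 1 = t 2"
          show "t \<notin> Pi\<^sub>E {1..3} A"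
          proof
            assume "t \<in> Pi\<^sub>E {1..3} A"
            from PiE_mem[OF this, of 1] PiE_mem[OF this, of 2] have "t 1 \<in> U" "t 2 \<in> V"
              by (simp_all add: A_def)
            with t assms(3) show False by auto
          qed
        qed
        moreover have "Pi\<^sub>E {1..3} A \<in> sets P"
          unfolding P_def using A by (intro sets_PiM_I_finite) auto
        ultimately show ?thesis
          using emeasure_eq_0_AE[of "\<lambda>t. t \<in> Pi\<^sub>E {1..3} A" P] sets.sets_into_space[of "Pi\<^sub>E {1..3} A" P]
          by (simp add: Int_absorb1 Collect_conj_eq)
      qed
      ultimately show False by simp
    qed
  qed (unfold gap_def growth_def spread_def, measurable)
  then show ?thesis by (simp add: P.emeasure_space_1)
qed

end

section \<open>From the random walk to the shape of the triangle\<close>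

text \<open>
  The coordinate of the projection of the polygon to the \<open>i\<close>-th axis of the plane.
\<close>

definition plane_coord :: "polygon \<Rightarrow> 2 \<Rightarrow> complex" where
  "plane_coord Q i = triple_coord (\<lambda>j. Q j $ i)"

text \<open>
  The determinant of \<open>z\<close> and \<open>w\<close> as vectors of the plane.
\<close>

definition cross :: "complex \<Rightarrow> complex \<Rightarrow> real" where
  "cross z w = Im (cnj z * w)"

lemma cross_plane_coord_eq:
  "cross (plane_coord Q 1) (plane_coord Q 2) = - (sqrt 3 / 2) *
    ((Q 3 $ 1 - Q 1 $ 1) * (Q 2 $ 2 - Q 1 $ 2) - (Q 2 $ 1 - Q 1 $ 1) * (Q 3 $ 2 - Q 1 $ 2))"
  by (simp add: cross_def plane_coord_def triple_coord_Complex field_simps)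

lemma cross_plane_coord:
  "\<bar>cross (plane_coord Q 1) (plane_coord Q 2)\<bar> = sqrt 3 * polygon_area 3 Q"
proof -
  have img: "Q ` {1..3} = {Q 1, Q 2, Q 3}"
    by (auto simp: numeral_3_eq_3 numeral_2_eq_2 atLeastAtMostSuc_conv)
  have "polygon_area 3 Q
      = \<bar>(Q 3 $ 1 - Q 1 $ 1) * (Q 2 $ 2 - Q 1 $ 2) - (Q 2 $ 1 - Q 1 $ 1) * (Q 3 $ 2 - Q 1 $ 2)\<bar> / 2"
  proof -
    have "convex hull {Q 1, Q 2, Q 3} \<in> sets borel"
      by (intro borel_closed compact_imp_closed finite_imp_compact_convex_hull) simp
    then have "measure lebesgue (convex hull {Q 1, Q 2, Q 3}) = measure lborel (convex hull {Q 1, Q 2, Q 3})"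
      by (simp add: measure_completion)
    then show ?thesis unfolding polygon_area_def img content_triangle .
  qed
  then show ?thesis
    by (simp add: cross_plane_coord_eq abs_mult)
qed

lemma plane_coord_le_side:
  "cmod (plane_coord Q i) \<le> 2 * Max ((\<lambda>j. norm (side 3 Q j)) ` {1..3})"
proof -
  define S where "S = Max ((\<lambda>j. norm (side 3 Q j)) ` {1..3})"
  have S: "norm (side 3 Q j) \<le> S" if "j \<in> {1..3}" for j
    unfolding S_def using that by (intro Max_ge) auto
  have "rot3\<^sup>2 + rot3 + 1 = 0" unfolding rot3(3) by simp
  then have "plane_coord Q i = plane_coord Q i - (rot3\<^sup>2 + rot3 + 1) * of_real (Q 3 $ i)"
    by simp
  also have "\<dots> = rot3 * of_real ((Q 1 - Q 3) $ i) - rot3\<^sup>2 * of_real ((Q 3 - Q 2) $ i)"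
    by (simp add: plane_coord_def triple_coord_def algebra_simps)
  also have "cmod \<dots> \<le> \<bar>(Q 1 - Q 3) $ i\<bar> + \<bar>(Q 3 - Q 2) $ i\<bar>"
    by (rule order_trans[OF norm_triangle_ineq4])
      (simp add: norm_mult norm_power rot3(1) del: vector_minus_component)
  also have "\<dots> \<le> norm (side 3 Q 3) + norm (side 3 Q 2)"
    using component_le_norm_cart[of "side 3 Q 3" i] component_le_norm_cart[of "side 3 Q 2" i]
    by (simp add: side_def cyc_next_def numeral_3_eq_3 numeral_2_eq_2)
  also have "\<dots> \<le> 2 * S"
    using S[of 3] S[of 2] by simp
  finally show ?thesis by (simp add: S_def)
qed

lemma cross_stretch_map:
  "cross (a * z + b * cnj z) (a * w + b * cnj w) = ((cmod a)\<^sup>2 - (cmod b)\<^sup>2) * cross z w"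
  unfolding cmod_power2 by (simp add: cross_def power2_eq_square algebra_simps)

lemma cross_expansion:
  assumes "cross w1 w2 \<noteq> 0"
  shows "z = of_real (cross z w2 / cross w1 w2) * w1 - of_real (cross z w1 / cross w1 w2) * w2"
proof -
  have "of_real (cross w1 w2) * z = of_real (cross z w2) * w1 - of_real (cross z w1) * w2"
    by (simp add: cross_def complex_eq_iff algebra_simps)
  then show ?thesis using assms by (simp add: field_simps)
qed

lemma abs_cross_le: "\<bar>cross z w\<bar> \<le> cmod z * cmod w"
  unfolding cross_def using abs_Im_le_cmod[of "cnj z * w"] by (simp add: norm_mult)

lemma linear_step: "linear (step t)"
  unfolding step_def by (rule linear_stretch)

lemma linear_orbit: "linear (orbit step y n)"
proof (induction n)
  case 0
  have "orbit step y 0 = (\<lambda>z. z)" by (simp add: fun_eq_iff)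
  then show ?case by (auto intro: linearI)
next
  case (Suc n)
  have "orbit step y (Suc n) = step (y (Suc n)) \<circ> orbit step y n" by (simp add: fun_eq_iff)
  show ?case unfolding \<open>orbit step y (Suc n) = _\<close> by (rule linear_compose[OF Suc linear_step])
qed

lemma plane_coord_subdivide:
  "plane_coord (subdivide 3 t Q) i = mean_coeff t * plane_coord Q i + dev_coeff t * cnj (plane_coord Q i)"
  unfolding plane_coord_def triple_coord_subdivide[symmetric]
  by (simp add: subdivide_def side_def)

lemma sqrt_area_factor_step:
  assumes "area_factor t > 0"
  shows "of_real (sqrt (area_factor t)) * step t z = mean_coeff t * z + dev_coeff t * cnj z"
  using assms by (simp add: step_def stretch_def coeff_norms)

text \<open>
  Both projections of the triangle move under the same area-preserving orbit, once the scale
  \<open>sqrt (\<Delta> n)\<close> is split off; \<open>\<Delta> n\<close> is the factor by which the area has shrunk.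
\<close>

lemma plane_coord_subdivision:
  fixes x :: "nat \<Rightarrow> nat \<Rightarrow> real"
  assumes x: "\<And>j n. j \<in> {1..3} \<Longrightarrow> n \<ge> 1 \<Longrightarrow> x j n \<in> {0<..<1}"
  defines "\<Delta> \<equiv> \<lambda>n. \<Prod>m\<in>{1..n}. area_factor (\<lambda>j. x j m)"
  shows "plane_coord (subdivision 3 Q x n) i
      = of_real (sqrt (\<Delta> n)) * orbit step (\<lambda>m j. x j m) n (plane_coord Q i)"
    and "\<Delta> n > 0"
    and "polygon_area 3 (subdivision 3 Q x n) = \<Delta> n * polygon_area 3 Q"
proof -
  have pos: "area_factor (\<lambda>j. x j (Suc m)) > 0" for m
    by (rule area_factor_pos) (use x[of _ "Suc m"] in auto)
  have S: "\<Delta> (Suc n) = \<Delta> n * area_factor (\<lambda>j. x j (Suc n))" for n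
    by (simp add: \<Delta>_def)
  show \<Delta>: "\<Delta> n > 0" for n
    by (induction n) (simp_all add: S pos, simp add: \<Delta>_def)
  show "plane_coord (subdivision 3 Q x n) i
      = of_real (sqrt (\<Delta> n)) * orbit step (\<lambda>m j. x j m) n (plane_coord Q i)"
  proof (induction n)
    case (Suc n)
    let ?t = "\<lambda>j. x j (Suc n)" and ?w = "orbit step (\<lambda>m j. x j m) n (plane_coord Q i)"
    have "plane_coord (subdivision 3 Q x (Suc n)) i
       = of_real (sqrt (\<Delta> n)) * (mean_coeff ?t * ?w + dev_coeff ?t * cnj ?w)"
      by (simp add: plane_coord_subdivide Suc algebra_simps)
    also have "\<dots> = of_real (sqrt (\<Delta> n)) * (of_real (sqrt (area_factor ?t)) * step ?t ?w)"
      by (simp only: sqrt_area_factor_step[OF pos])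
    finally show ?case by (simp add: S real_sqrt_mult mult_ac)
  qed (simp add: \<Delta>_def)
  have "cross (plane_coord (subdivision 3 Q x n) 1) (plane_coord (subdivision 3 Q x n) 2)
      = \<Delta> n * cross (plane_coord Q 1) (plane_coord Q 2)"
    by (induction n) (simp_all add: plane_coord_subdivide cross_stretch_map coeff_norms S, simp add: \<Delta>_def)
  then have "sqrt 3 * polygon_area 3 (subdivision 3 Q x n) = \<Delta> n * (sqrt 3 * polygon_area 3 Q)"
    unfolding cross_plane_coord[symmetric] using \<Delta>[of n] by (simp add: abs_mult)
  then show "polygon_area 3 (subdivision 3 Q x n) = \<Delta> n * polygon_area 3 Q"
    by simp
qed

text \<open>
  The two projections of the initial triangle form a basis of the plane, so the longest side of the
  \<open>n\<close>-th triangle, divided by \<open>sqrt (\<Delta> n)\<close>, bounds the operator norm of the area-preserving orbit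
  map up to a constant. Hence a disc whose radius is of the order of \<open>sqrt (\<Delta> n)\<close> over the longest
  side, or the unit disc if that is smaller, stays in the unit disc at time \<open>n\<close>. Its area tends to
  \<open>0\<close> by assumption, and it is proportional to the ratio that has to tend to \<open>0\<close>.
\<close>

lemma flat_of_escape:
  fixes x :: "nat \<Rightarrow> nat \<Rightarrow> real"
  assumes x: "\<And>j n. j \<in> {1..3} \<Longrightarrow> n \<ge> 1 \<Longrightarrow> x j n \<in> {0<..<1}"
    and nondeg: "cross (plane_coord L0 1) (plane_coord L0 2) \<noteq> 0"
    and escape: "(\<lambda>n. measure lborel {z \<in> ball 0 1. orbit step (\<lambda>m j. x j m) n z \<in> ball 0 1}) \<longlonglongrightarrow> 0"
  shows "converges_to_flat 3 (subdivision 3 L0 x)"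
proof -
  define L where "L = subdivision 3 L0 x"
  define \<Delta> where "\<Delta> n = (\<Prod>m\<in>{1..n}. area_factor (\<lambda>j. x j m))" for n
  define A where "A n = orbit step (\<lambda>m j. x j m) n" for n
  have sub: "plane_coord (L n) i = of_real (sqrt (\<Delta> n)) * A n (plane_coord L0 i)"
    "\<Delta> n > 0" "polygon_area 3 (L n) = \<Delta> n * polygon_area 3 L0" for n i
    unfolding L_def \<Delta>_def A_def by (rule plane_coord_subdivision; rule x; assumption)+
  define S where "S n = Max ((\<lambda>j. norm (side 3 (L n) j)) ` {1..3})" for n
  define w1 w2 where "w1 = plane_coord L0 1" and "w2 = plane_coord L0 2"
  have w: "cross w1 w2 \<noteq> 0" using nondeg by (simp add: w1_def w2_def)
  define K where "K = 2 * (cmod w1 + cmod w2) / \<bar>cross w1 w2\<bar>"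
  have "w1 \<noteq> 0" using w by (auto simp: cross_def)
  then have K: "K > 0" using w by (simp add: K_def add_pos_nonneg)
  have S0: "S n \<ge> 0" for n
  proof -
    have "norm (side 3 (L n) 1) \<le> S n" unfolding S_def by (intro Max_ge) auto
    then show ?thesis by (rule order_trans[OF norm_ge_zero])
  qed
  have bound: "cmod (A n z) \<le> K * S n / sqrt (\<Delta> n) * cmod z" for n z
  proof -
    have "sqrt (\<Delta> n) * cmod (A n (plane_coord L0 i)) = cmod (plane_coord (L n) i)" for i
      using sub(1)[of n i] sub(2)[of n] by (simp add: norm_mult)
    then have Aw: "cmod (A n (plane_coord L0 i)) \<le> 2 * S n / sqrt (\<Delta> n)" for i
      using plane_coord_le_side[of "L n" i] sub(2)[of n] by (simp add: S_def field_simps)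
    have lin: "linear (A n)" unfolding A_def by (rule linear_orbit)
    define p q where "p = cross z w2 / cross w1 w2" and "q = cross z w1 / cross w1 w2"
    have "z = p *\<^sub>R w1 - q *\<^sub>R w2"
      using cross_expansion[OF w, of z] by (simp add: p_def q_def scaleR_conv_of_real)
    then have "A n z = p *\<^sub>R A n w1 - q *\<^sub>R A n w2"
      using linear_diff[OF lin] linear_scale[OF lin] by metis
    then have "cmod (A n z) \<le> \<bar>p\<bar> * cmod (A n w1) + \<bar>q\<bar> * cmod (A n w2)"
      using norm_triangle_ineq4[of "p *\<^sub>R A n w1" "q *\<^sub>R A n w2"] by simp
    also have "\<dots> \<le> (cmod z * cmod w2 / \<bar>cross w1 w2\<bar>) * (2 * S n / sqrt (\<Delta> n))
        + (cmod z * cmod w1 / \<bar>cross w1 w2\<bar>) * (2 * S n / sqrt (\<Delta> n))"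
      using Aw[of 1] Aw[of 2] abs_cross_le[of z w2] abs_cross_le[of z w1]
      by (intro add_mono mult_mono) (auto simp: p_def q_def w1_def w2_def intro!: divide_right_mono)
    also have "\<dots> = K * S n / sqrt (\<Delta> n) * cmod z"
      by (simp add: K_def field_simps add_divide_distrib)
    finally show ?thesis .
  qed
  define V where "V = measure lborel (ball (0 :: complex) 1)"
  have V: "V > 0" unfolding V_def by (rule content_ball_pos) simp
  define r where "r n = sqrt (\<Delta> n) / (K * S n)" for n
  have r0: "r n \<ge> 0" for n using S0[of n] K sub(2)[of n] by (simp add: r_def)
  define E where "E n = {z \<in> ball 0 1. A n z \<in> ball 0 1}" for n
  have E: "E n \<in> sets borel" "emeasure lborel (E n) < \<infinity>" for n
  proof -
    have lin: "linear (A n)" unfolding A_def by (rule linear_orbit)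
    have [measurable]: "A n \<in> borel_measurable borel"
      using lin by (intro borel_measurable_continuous_onI linear_continuous_on linear_conv_bounded_linear[THEN iffD1])
    have "{z \<in> space borel. norm z < 1 \<and> norm (A n z) < 1} \<in> sets borel"
      by measurable
    then show m: "E n \<in> sets borel" by (simp add: E_def)
    have "emeasure lborel (E n) \<le> emeasure lborel (ball (0 :: complex) 1)"
      by (intro emeasure_mono) (auto simp: E_def)
    also have "\<dots> < \<infinity>" by (rule emeasure_lborel_ball_finite)
    finally show "emeasure lborel (E n) < \<infinity>" .
  qed
  have low: "min 1 ((r n)\<^sup>2) \<le> measure lborel (E n) / V" for n
  proof -
    have "ball 0 (min 1 (r n)) \<subseteq> E n"
    proof
      fix z :: complex assume z: "z \<in> ball 0 (min 1 (r n))"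
      then have "r n > 0" using norm_ge_zero[of z] by (auto simp del: norm_ge_zero)
      then have "S n > 0" using S0[of n] by (cases "S n = 0") (auto simp: r_def)
      then have "K * S n / sqrt (\<Delta> n) * cmod z < 1"
        using z K sub(2)[of n] by (simp add: r_def field_simps)
      with bound[of n z] have "cmod (A n z) < 1" by linarith
      then show "z \<in> E n" using z by (simp add: E_def)
    qed
    then have "measure lborel (ball (0 :: complex) (min 1 (r n))) \<le> measure lborel (E n)"
      using E[of n] by (intro measure_mono_fmeasurable) (auto simp: fmeasurable_def)
    moreover have "measure lborel (ball (0 :: complex) (min 1 (r n))) = (min 1 (r n))\<^sup>2 * V"
      using r0[of n] content_ball_conv_unit_ball[of "min 1 (r n)" "0 :: complex"] by (simp add: V_def)
    moreover have "(min 1 (r n))\<^sup>2 = min 1 ((r n)\<^sup>2)"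
      using r0[of n] power_le_one[of "r n" 2] one_le_power[of "r n" 2]
      by (cases "r n \<le> 1") (auto simp: min_def)
    ultimately show ?thesis using V by (simp add: field_simps)
  qed
  have lim: "(\<lambda>n. measure lborel (E n) / V) \<longlonglongrightarrow> 0"
    using tendsto_divide[OF escape tendsto_const[of V]] V by (simp add: E_def A_def)
  have "(\<lambda>n. (r n)\<^sup>2) \<longlonglongrightarrow> 0"
  proof (rule tendsto_sandwich[OF _ _ tendsto_const lim])
    have "\<forall>\<^sub>F n in sequentially. measure lborel (E n) / V < 1"
      by (rule order_tendstoD(2)[OF lim]) simp
    then show "\<forall>\<^sub>F n in sequentially. (r n)\<^sup>2 \<le> measure lborel (E n) / V"
    proof (rule eventually_mono)
      fix n assume "measure lborel (E n) / V < 1"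
      then show "(r n)\<^sup>2 \<le> measure lborel (E n) / V"
        using low[of n] by linarith
    qed
  qed auto
  then have "(\<lambda>n. K\<^sup>2 * polygon_area 3 L0 * (r n)\<^sup>2) \<longlonglongrightarrow> 0"
    by (rule tendsto_mult_right_zero)
  moreover have "K\<^sup>2 * polygon_area 3 L0 * (r n)\<^sup>2 = polygon_area 3 (L n) / (S n)\<^sup>2" for n
    using K sub(2)[of n] by (simp add: sub(3) r_def power_mult_distrib power_divide)
  ultimately show ?thesis
    by (simp add: converges_to_flat_def L_def S_def)
qed

section \<open>Almost sure flatness\<close>

text \<open>
  Every point outside the support has a basic neighbourhood of measure \<open>0\<close>, and there are countably
  many of these.
\<close>

lemma AE_measure_support:
  fixes \<mu> :: "'a :: second_countable_topology measure"
  assumes "sets \<mu> = sets borel"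
  shows "AE x in \<mu>. x \<in> measure_support \<mu>"
proof -
  obtain B :: "'a set set" where B: "countable B" "topological_basis B"
    using ex_countable_basis by blast
  define C where "C = {U \<in> B. emeasure \<mu> U = 0}"
  have null: "U \<in> null_sets \<mu>" if "U \<in> C" for U
    using that B(2) assms by (auto simp: C_def null_sets_def topological_basis_open)
  have "countable C" using B(1) by (simp add: C_def)
  then have "(\<Union>U\<in>C. U) \<in> null_sets \<mu>"
    using null by (intro null_sets_UN') auto
  moreover have "- measure_support \<mu> \<subseteq> (\<Union>U\<in>C. U)"
  proof
    fix x assume "x \<in> - measure_support \<mu>"
    then obtain U where U: "open U" "x \<in> U" "emeasure \<mu> U = 0"
      by (auto simp: measure_support_def)
    then obtain V where V: "V \<in> B" "x \<in> V" "V \<subseteq> U"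
      using B(2) by (auto elim: topological_basisE)
    have "emeasure \<mu> V \<le> emeasure \<mu> U"
      using V U assms by (intro emeasure_mono) auto
    then show "x \<in> (\<Union>U\<in>C. U)" using V U by (auto simp: C_def)
  qed
  ultimately show ?thesis
    by (intro AE_I'[of "\<Union>U\<in>C. U"]) auto
qed

lemma cross_nonzero_of_noncollinear:
  assumes "\<not> collinear {Q 1, Q 2, Q 3 :: real^2}"
  shows "cross (plane_coord Q 1) (plane_coord Q 2) \<noteq> 0"
proof
  assume "cross (plane_coord Q 1) (plane_coord Q 2) = 0"
  define u v where "u = Q 1 - Q 2" and "v = Q 3 - Q 2"
  have "u $ 1 * v $ 2 = u $ 2 * v $ 1"
    using \<open>cross (plane_coord Q 1) (plane_coord Q 2) = 0\<close> unfolding cross_plane_coord_eq mult_eq_0_iff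
    by (simp add: u_def v_def algebra_simps)
  have "collinear {0, u, v}"
  proof (cases "v = 0")
    case True
    then show ?thesis by (simp add: collinear_lemma insert_commute)
  next
    case False
    then have "(v $ 1)\<^sup>2 + (v $ 2)\<^sup>2 \<noteq> 0"
      by (auto simp: vec_eq_iff forall_2 sum_power2_eq_zero_iff)
    define c where "c = (u $ 1 * v $ 1 + u $ 2 * v $ 2) / ((v $ 1)\<^sup>2 + (v $ 2)\<^sup>2)"
    have "u $ 1 * ((v $ 1)\<^sup>2 + (v $ 2)\<^sup>2) = (u $ 1 * v $ 1 + u $ 2 * v $ 2) * v $ 1"
      "u $ 2 * ((v $ 1)\<^sup>2 + (v $ 2)\<^sup>2) = (u $ 1 * v $ 1 + u $ 2 * v $ 2) * v $ 2"
      using \<open>u $ 1 * v $ 2 = u $ 2 * v $ 1\<close> by algebra+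
    then have "u = c *\<^sub>R v"
      using \<open>(v $ 1)\<^sup>2 + (v $ 2)\<^sup>2 \<noteq> 0\<close> by (simp add: vec_eq_iff forall_2 c_def field_simps)
    then have "collinear {0, v, u}" by (auto simp: collinear_lemma)
    then show ?thesis by (simp add: insert_commute)
  qed
  then have "collinear {Q 1, Q 2, Q 3}"
    unfolding u_def v_def by (subst collinear_3) (simp_all add: NO_MATCH_def)
  with assms show False by simp
qed

theorem theorem2p2:
  fixes N :: "'b measure" and \<xi> :: "'b \<Rightarrow> real"
    and M :: "'a measure" and X :: "nat \<Rightarrow> nat \<Rightarrow> 'a \<Rightarrow> real"
    and L0 :: polygon
  assumes "prob_space N" and "\<xi> \<in> borel_measurable N"
    and "measure_support (distr N borel \<xi>) \<subseteq> {0..1}"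
    and "measure N {\<omega> \<in> space N. \<xi> \<omega> \<in> {0, 1}} = 0"
    and "\<exists>a b. a \<noteq> b \<and> {a, b} \<subseteq> measure_support (distr N borel \<xi>) \<inter> {0<..<1}"
    and "prob_space M"
    and "prob_space.indep_vars M (\<lambda>_. borel) (\<lambda>(j, n). X j n) ({1..3} \<times> {1..})"
    and "\<And>j n. j \<in> {1..3} \<Longrightarrow> n \<ge> 1 \<Longrightarrow> distr M borel (X j n) = distr N borel \<xi>"
    and "\<not> collinear {L0 1, L0 2, L0 3}"
  shows "AE \<omega> in M. converges_to_flat 3 (subdivision 3 L0 (\<lambda>j n. X j n \<omega>))"
proof -
  interpret N: prob_space N by fact
  interpret M: prob_space M by fact
  define \<mu> where "\<mu> = distr N borel \<xi>"
  define P where "P = (\<Pi>\<^sub>M i\<in>{1..3::nat}. \<mu>)"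
  interpret \<mu>: prob_space \<mu>
    unfolding \<mu>_def using assms(2) by (rule N.prob_space_distr)
  have sets_\<mu>: "sets \<mu> = sets borel" by (simp add: \<mu>_def)
  have sets_P: "sets P = sets (\<Pi>\<^sub>M i\<in>{1..3}. borel)"
    unfolding P_def by (intro sets_PiM_cong) (auto simp: sets_\<mu>)
  have P: "prob_space P"
    unfolding P_def by (rule prob_space_PiM) (rule \<mu>.prob_space_axioms)
  have "AE x in \<mu>. x \<in> {0..1}"
    using AE_measure_support[OF sets_\<mu>]
    by (rule eventually_mono) (use assms(3) in \<open>auto simp: \<mu>_def\<close>)
  moreover have "AE x in \<mu>. x \<notin> {0, 1}"
  proof -
    have "emeasure N {\<omega> \<in> space N. \<xi> \<omega> \<in> {0, 1}} = 0"
      using assms(4) by (simp add: N.emeasure_eq_measure)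
    then have "AE \<omega> in N. \<xi> \<omega> \<notin> {0, 1}"
      using assms(2) by (subst AE_iff_measurable[OF _ refl]) auto
    then show ?thesis
      unfolding \<mu>_def using assms(2) by (subst AE_distr_iff) auto
  qed
  ultimately have unit: "AE x in \<mu>. x \<in> {0<..<1}"
    by eventually_elim auto
  from assms(5) obtain a b where ab: "a \<noteq> b" "a \<in> measure_support \<mu>" "b \<in> measure_support \<mu>"
    by (auto simp: \<mu>_def)
  obtain U V where UV: "open U" "open V" "a \<in> U" "b \<in> V" "U \<inter> V = {}"
    using hausdorff[OF ab(1)] by blast
  have \<rho>': "rate \<mu> < 1"
    unfolding P_def
    by (rule rate_less_1[OF \<mu>.prob_space_axioms sets_\<mu> unit, of U V])
      (use UV ab in \<open>auto simp: measure_support_def\<close>)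
  \<comment> \<open>The maximum keeps the rate positive.\<close>
  define \<rho> where "\<rho> = max (1 / 2) (enn2real (rate \<mu>))"
  have rate: "rate \<mu> \<le> ennreal \<rho>"
  proof -
    have "rate \<mu> < top" using \<rho>' by (rule order_less_trans) simp
    then have "rate \<mu> = ennreal (enn2real (rate \<mu>))" by simp
    also have "\<dots> \<le> ennreal \<rho>" by (intro ennreal_leI) (simp add: \<rho>_def)
    finally show ?thesis .
  qed
  have \<rho>: "0 < \<rho>" "\<rho> < 1"
  proof -
    have "enn2real (rate \<mu>) < 1"
      using \<rho>' by (cases "rate \<mu>") auto
    then show "\<rho> < 1" by (simp add: \<rho>_def)
  qed (simp add: \<rho>_def)
  define Y where "Y n \<omega> = (\<lambda>j\<in>{1..3::nat}. X j n \<omega>)" for n \<omega>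
  have Xm[measurable]: "X j n \<in> borel_measurable M" if "j \<in> {1..3}" "n \<ge> 1" for j n
    using assms(7) that by (auto simp: M.indep_vars_def)
  define R where "R n \<omega> = restrict (\<lambda>i. (\<lambda>(j, n). X j n) i \<omega>) ({1..3} \<times> {n})" for n :: nat and \<omega>
  define h where "h n y = (\<lambda>j\<in>{1..3::nat}. y (j, n))" for n :: nat and y :: "nat \<times> nat \<Rightarrow> real"
  have Y_eq: "Y n \<omega> = h n (R n \<omega>)" for n \<omega>
    by (auto simp: Y_def h_def R_def)
  have h: "h n \<in> (\<Pi>\<^sub>M i\<in>{1..3} \<times> {n}. borel) \<rightarrow>\<^sub>M P" for n
    unfolding measurable_cong_sets[OF refl sets_P] h_def
    by (intro measurable_restrict measurable_component_singleton) auto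
  have "M.indep_vars (\<lambda>n. \<Pi>\<^sub>M i\<in>{1..3} \<times> {n}. borel) R {1..}"
    unfolding R_def by (rule M.indep_vars_restrict[OF assms(7)]) (auto simp: disjoint_family_on_def)
  then have indep: "M.indep_vars (\<lambda>_. P) Y {1..}"
    using M.indep_vars_compose2[of "\<lambda>n. \<Pi>\<^sub>M i\<in>{1..3} \<times> {n}. borel" R "{1..}" h "\<lambda>_. P"] h
    by (simp add: Y_eq[abs_def])
  have law: "distr M P (Y n) = P" if "n \<ge> 1" for n
  proof -
    let ?I = "{1..3::nat} \<times> {n}"
    have ind: "M.indep_vars (\<lambda>_. borel) (\<lambda>(j, n). X j n) ?I"
      by (rule M.indep_vars_subset[OF assms(7)]) (use that in auto)
    have rv: "(\<lambda>(j, n). X j n) i \<in> borel_measurable M" if "i \<in> ?I" for i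
      using ind that by (auto simp: M.indep_vars_def)
    have R: "R n \<in> M \<rightarrow>\<^sub>M (\<Pi>\<^sub>M i\<in>?I. borel)"
      unfolding R_def by (intro measurable_restrict rv)
    have "distr M (\<Pi>\<^sub>M i\<in>?I. borel) (R n) = (\<Pi>\<^sub>M i\<in>?I. distr M borel ((\<lambda>(j, n). X j n) i))"
      using M.indep_vars_iff_distr_eq_PiM'[of ?I "\<lambda>(j, n). X j n" "\<lambda>_. borel"] ind rv
      by (simp add: R_def[abs_def])
    also have "\<dots> = (\<Pi>\<^sub>M i\<in>?I. \<mu>)"
      using that assms(8) by (intro PiM_cong) (auto simp: \<mu>_def)
    finally have RI: "distr M (\<Pi>\<^sub>M i\<in>?I. borel) (R n) = (\<Pi>\<^sub>M i\<in>?I. \<mu>)" .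
    have "distr M P (Y n) = distr (distr M (\<Pi>\<^sub>M i\<in>?I. borel) (R n)) P (h n)"
      by (subst distr_distr[OF h R]) (simp add: Y_eq[abs_def] comp_def)
    also have "\<dots> = distr (\<Pi>\<^sub>M i\<in>?I. \<mu>) P (h n)"
      by (simp only: RI)
    also have "\<dots> = P"
      using distr_PiM_reindex[of ?I "\<lambda>_. \<mu>" "\<lambda>j. (j, n)" "{1..3}"] \<mu>.prob_space_axioms
      by (simp add: P_def h_def[abs_def] inj_on_def)
    finally show ?thesis .
  qed
  have G: "case_prod step \<in> P \<Otimes>\<^sub>M borel \<rightarrow>\<^sub>M borel"
    unfolding P_def by (rule step_measurable[OF \<mu>.prob_space_axioms sets_\<mu> unit])
  have "AE \<omega> in M. (\<lambda>n. measure lborel {z \<in> ball 0 1. orbit step (\<lambda>i. Y i \<omega>) n z \<in> ball 0 1}) \<longlonglongrightarrow> 0"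
  proof (rule escape_of_L2_contraction[OF assms(6) P G indep law \<rho>])
    fix f :: "complex \<Rightarrow> real"
    assume f: "f \<in> borel_measurable borel" "\<And>z. f z \<in> {0..1}" "(\<integral>\<^sup>+z. ennreal ((f z)\<^sup>2) \<partial>lborel) < \<infinity>"
    have "(\<integral>\<^sup>+z. ennreal ((step_op P step f z)\<^sup>2) \<partial>lborel) \<le> rate \<mu> * (\<integral>\<^sup>+z. ennreal ((f z)\<^sup>2) \<partial>lborel)"
      unfolding P_def by (rule step_op_contraction[OF \<mu>.prob_space_axioms sets_\<mu> unit f])
    also have "\<dots> \<le> ennreal \<rho> * (\<integral>\<^sup>+z. ennreal ((f z)\<^sup>2) \<partial>lborel)"
      by (intro mult_right_mono rate) simp
    finally show "(\<integral>\<^sup>+z. ennreal ((step_op P step f z)\<^sup>2) \<partial>lborel) \<le> ennreal \<rho> * (\<integral>\<^sup>+z. ennreal ((f z)\<^sup>2) \<partial>lborel)" .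
  qed (use emeasure_lborel_ball_finite in auto)
  moreover have "AE \<omega> in M. \<forall>i\<in>{1..3} \<times> {1..}. case i of (j, n) \<Rightarrow> X j n \<omega> \<in> {0<..<1}"
  proof (subst AE_ball_countable)
    show "\<forall>i\<in>{1..3} \<times> {1..}. AE \<omega> in M. case i of (j, n) \<Rightarrow> X j n \<omega> \<in> {0<..<1}"
    proof
      fix i :: "nat \<times> nat" assume "i \<in> {1..3} \<times> {1..}"
      then obtain j n where i: "i = (j, n)" and jn: "j \<in> {1..3}" "n \<ge> 1"
        by auto
      then have eq: "distr M borel (X j n) = \<mu>"
        using assms(8) by (simp add: \<mu>_def)
      have "AE x in distr M borel (X j n). x \<in> {0<..<1}"
        unfolding eq by (rule unit)
      from AE_distrD[OF Xm[OF jn] this]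
      show "AE \<omega> in M. case i of (j, n) \<Rightarrow> X j n \<omega> \<in> {0<..<1}"
        by (simp only: i prod.case)
    qed
  qed auto
  ultimately show ?thesis
  proof eventually_elim
    case (elim \<omega>)
    have step_Y: "step (Y n \<omega>) = step (\<lambda>j. X j n \<omega>)" for n
      by (simp add: step_def mean_coeff_def dev_coeff_def Y_def)
    have "orbit step (\<lambda>i. Y i \<omega>) n z = orbit step (\<lambda>n j. X j n \<omega>) n z" for n z
      by (induction n) (simp_all add: step_Y)
    with elim show ?case
      by (intro flat_of_escape cross_nonzero_of_noncollinear assms(9)) auto
  qed
qed

end
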